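(* For all $m \geq 2$, every graph without loops is the Reeb space of a smooth function on a closed $m$-dimensional manifold with finitely many critical values.
   Context: Smooth means of class $C^\infty$. A manifold is closed if it is compact and has no boundary (not assumed connected). A graph means a finite multigraph (multi-edges allowed), regarded as a topological space as a compact CW complex of dimension at most $1$. Reeb space: for a continuous map $f : X \to Y$ and $x_0, x_1 \in X$, write $x_0 \sim x_1$ if $f(x_0) = f(x_1)$ and $x_0, x_1$ lie on the same connected component of $f^{-1}(f(x_0))$. The Reeb space $W_f = X/\!\sim$ carries the quotient topology, and $q_f : X \to W_f$ is the quotient map. For a smooth function $f$ with finitely many critical values on a closed manifold of dimension $m \geq 2$, $W_f$ has the structure of a graph whose vertices are exactly the $q_f$-images of the connected components of level sets of $f$ that contain critical points. That a graph $G$ is the Reeb space of $f$ means that there is a homeomorphism $G \to W_f$ carrying vertices to vertices and edges to edges. *)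

theory Defs
  imports "HOL-Analysis.Analysis"
begin

section \<open>Smooth maps between Euclidean spaces\<close>

text \<open>
  Class \<open>C\<^sup>k\<close> on a set \<open>S\<close>, intended for open \<open>S\<close> only: the \<open>k\<close>-fold iterated directional
  derivatives exist and are continuous on \<open>S\<close>. All derivatives are taken with respect to the
  whole space, so values of \<open>f\<close> outside an open \<open>S\<close> are irrelevant.
\<close>

primrec Ck_on :: "nat \<Rightarrow> 'a::real_normed_vector set \<Rightarrow> ('a \<Rightarrow> 'b::real_normed_vector) \<Rightarrow> bool" where
  "Ck_on 0 S f \<longleftrightarrow> continuous_on S f"
| "Ck_on (Suc k) S f \<longleftrightarrow>
     (\<forall>x\<in>S. f differentiable (at x)) \<and>
     (\<forall>v. Ck_on k S (\<lambda>x. frechet_derivative f (at x) v))"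

definition smooth_on :: "'a::real_normed_vector set \<Rightarrow> ('a \<Rightarrow> 'b::real_normed_vector) \<Rightarrow> bool" where
  "smooth_on S f \<longleftrightarrow> (\<forall>k. Ck_on k S f)"


section \<open>Smooth manifolds\<close>

text \<open>
  A chart is a pair \<open>(U, \<phi>)\<close> of an open set and a map whose values outside \<open>U\<close> are irrelevant.
  Atlases are not required to be maximal; every atlas determines a unique maximal one,
  and with it the same smooth functions and critical points.

  For existence statements about \<open>m\<close>-manifolds, points may be taken in the type
  \<open>nat \<times> (real ^ 'm)\<close> without loss of generality: a second countable manifold has a countable
  atlas, and a point is determined by the first chart containing it and its coordinates there.
  The topology on the points is always the one given by \<open>M\<close>, not the one of this type.
\<close>

type_synonym ('a, 'e) atlas = "('a set \<times> ('a \<Rightarrow> 'e)) set"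

definition chart :: "'a topology \<Rightarrow> 'a set \<Rightarrow> ('a \<Rightarrow> 'e::euclidean_space) \<Rightarrow> bool" where
  "chart M U \<phi> \<longleftrightarrow>
     openin M U \<and> open (\<phi> ` U) \<and>
     homeomorphic_map (subtopology M U) (top_of_set (\<phi> ` U)) \<phi>"

definition smooth_manifold :: "'a topology \<Rightarrow> ('a, 'e::euclidean_space) atlas \<Rightarrow> bool" where
  "smooth_manifold M A \<longleftrightarrow>
     Hausdorff_space M \<and> second_countable M \<and>
     (\<forall>(U, \<phi>)\<in>A. chart M U \<phi>) \<and>
     (\<Union>(U, \<phi>)\<in>A. U) = topspace M \<and>
     (\<forall>(U, \<phi>)\<in>A. \<forall>(V, \<psi>)\<in>A. smooth_on (\<phi> ` (U \<inter> V)) (\<psi> \<circ> inv_into U \<phi>))"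

text \<open>
  Charts map onto open subsets of a Euclidean space, so these manifolds have no boundary.
\<close>

definition closed_smooth_manifold :: "'a topology \<Rightarrow> ('a, 'e::euclidean_space) atlas \<Rightarrow> bool" where
  "closed_smooth_manifold M A \<longleftrightarrow> smooth_manifold M A \<and> compact_space M"

definition smooth_function ::
  "('a, 'e::euclidean_space) atlas \<Rightarrow> ('a \<Rightarrow> real) \<Rightarrow> bool" where
  "smooth_function A f \<longleftrightarrow> (\<forall>(U, \<phi>)\<in>A. smooth_on (\<phi> ` U) (f \<circ> inv_into U \<phi>))"

definition critical_points ::
  "('a, 'e::euclidean_space) atlas \<Rightarrow> ('a \<Rightarrow> real) \<Rightarrow> 'a set" where
  "critical_points A f =
     {p. \<exists>(U, \<phi>)\<in>A. p \<in> U \<and> ((f \<circ> inv_into U \<phi>) has_derivative (\<lambda>_. 0)) (at (\<phi> p))}"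

definition critical_values ::
  "('a, 'e::euclidean_space) atlas \<Rightarrow> ('a \<Rightarrow> real) \<Rightarrow> real set" where
  "critical_values A f = f ` critical_points A f"


section \<open>Reeb spaces\<close>

definition reeb_rel :: "'a topology \<Rightarrow> ('a \<Rightarrow> 'b) \<Rightarrow> ('a \<times> 'a) set" where
  "reeb_rel X f =
     {(x0, x1). x0 \<in> topspace X \<and> x1 \<in> topspace X \<and> f x0 = f x1 \<and>
        connected_component_of (subtopology X {x \<in> topspace X. f x = f x0}) x0 x1}"

definition reeb_proj :: "'a topology \<Rightarrow> ('a \<Rightarrow> 'b) \<Rightarrow> 'a \<Rightarrow> 'a set" where
  "reeb_proj X f x = reeb_rel X f `` {x}"

definition reeb_space :: "'a topology \<Rightarrow> ('a \<Rightarrow> 'b) \<Rightarrow> 'a set topology" where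
  "reeb_space X f =
     topology (\<lambda>U. U \<subseteq> topspace X // reeb_rel X f \<and>
                   openin X {x \<in> topspace X. reeb_proj X f x \<in> U})"

lemma openin_reeb_space:
  "openin (reeb_space X f) U \<longleftrightarrow>
     U \<subseteq> topspace X // reeb_rel X f \<and> openin X {x \<in> topspace X. reeb_proj X f x \<in> U}"
proof -
  have "istopology (\<lambda>U. U \<subseteq> topspace X // reeb_rel X f \<and>
                        openin X {x \<in> topspace X. reeb_proj X f x \<in> U})"
    unfolding istopology_def
  proof (intro conjI allI impI)
    fix S T
    assume "S \<subseteq> topspace X // reeb_rel X f \<and> openin X {x \<in> topspace X. reeb_proj X f x \<in> S}"
      and "T \<subseteq> topspace X // reeb_rel X f \<and> openin X {x \<in> topspace X. reeb_proj X f x \<in> T}"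
    moreover have "{x \<in> topspace X. reeb_proj X f x \<in> S \<inter> T} =
        {x \<in> topspace X. reeb_proj X f x \<in> S} \<inter> {x \<in> topspace X. reeb_proj X f x \<in> T}"
      by blast
    ultimately show "S \<inter> T \<subseteq> topspace X // reeb_rel X f"
      and "openin X {x \<in> topspace X. reeb_proj X f x \<in> S \<inter> T}"
      by auto
  next
    fix K
    assume "\<forall>S\<in>K. S \<subseteq> topspace X // reeb_rel X f \<and>
                    openin X {x \<in> topspace X. reeb_proj X f x \<in> S}"
    moreover have "{x \<in> topspace X. reeb_proj X f x \<in> \<Union>K} =
        (\<Union>S\<in>K. {x \<in> topspace X. reeb_proj X f x \<in> S})"
      by blast
    ultimately show "\<Union>K \<subseteq> topspace X // reeb_rel X f"
      and "openin X {x \<in> topspace X. reeb_proj X f x \<in> \<Union>K}"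
      by auto
  qed
  then show ?thesis
    by (simp add: reeb_space_def topology_inverse')
qed

lemma topspace_reeb_space: "topspace (reeb_space X f) = topspace X // reeb_rel X f"
proof -
  have "{x \<in> topspace X. reeb_proj X f x \<in> topspace X // reeb_rel X f} = topspace X"
    by (auto simp: reeb_proj_def quotient_def)
  then have "openin (reeb_space X f) (topspace X // reeb_rel X f)"
    by (simp add: openin_reeb_space)
  then show ?thesis
    by (metis openin_reeb_space openin_subset openin_topspace subset_antisym)
qed

lemma quotient_map_reeb_proj: "quotient_map X (reeb_space X f) (reeb_proj X f)"
  by (auto simp: quotient_map_def topspace_reeb_space openin_reeb_space reeb_proj_def quotient_def)

lemma equiv_reeb_rel: "equiv (topspace X) (reeb_rel X f)"
proof (rule equivI)
  show "reeb_rel X f \<subseteq> topspace X \<times> topspace X"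
    by (auto simp: reeb_rel_def)
  show "refl_on (topspace X) (reeb_rel X f)"
    by (auto simp: refl_on_def reeb_rel_def connected_component_of_refl)
  show "sym (reeb_rel X f)"
    by (rule symI) (auto simp: reeb_rel_def connected_component_of_sym)
  show "trans (reeb_rel X f)"
    by (rule transI) (auto simp: reeb_rel_def intro: connected_component_of_trans)
qed

text \<open>
  A point of the Reeb space is, as a set, a connected component of a level set; the vertices
  are those components that contain a critical point. The edges are the open edges.
\<close>

definition reeb_vertices ::
  "'a topology \<Rightarrow> ('a, 'e::euclidean_space) atlas \<Rightarrow> ('a \<Rightarrow> real) \<Rightarrow> 'a set set" where
  "reeb_vertices M A f =
     {C \<in> topspace (reeb_space M f). C \<inter> critical_points A f \<noteq> {}}"

definition reeb_edges ::
  "'a topology \<Rightarrow> ('a, 'e::euclidean_space) atlas \<Rightarrow> ('a \<Rightarrow> real) \<Rightarrow> 'a set set set" where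
  "reeb_edges M A f =
     connected_components_of
       (subtopology (reeb_space M f) (topspace (reeb_space M f) - reeb_vertices M A f))"


section \<open>Graphs\<close>

text \<open>
  A finite multigraph as a finite CW complex of dimension at most one: \<open>V\<close> is the set of
  0-cells and \<open>E\<close> the set of open 1-cells. As \<open>c\<close> ranges over the characteristic maps of an
  edge, only the orientation and the parametrization vary; the endpoints are \<open>c 0\<close> and \<open>c 1\<close>.
  Distinct edges may have the same endpoints. For finitely many cells the
  Hausdorff condition gives the usual CW topology, and compactness.
\<close>

definition characteristic_map ::
  "'g topology \<Rightarrow> 'g set \<Rightarrow> 'g set \<Rightarrow> (real \<Rightarrow> 'g) \<Rightarrow> bool" where
  "characteristic_map G V e c \<longleftrightarrow>
     continuous_map (top_of_set {0..1}) G c \<and>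
     homeomorphic_map (top_of_set {0<..<1}) (subtopology G e) c \<and>
     c 0 \<in> V \<and> c 1 \<in> V"

definition graph :: "'g topology \<Rightarrow> 'g set \<Rightarrow> 'g set set \<Rightarrow> bool" where
  "graph G V E \<longleftrightarrow>
     Hausdorff_space G \<and>
     finite V \<and> V \<subseteq> topspace G \<and>
     finite E \<and> disjoint E \<and> \<Union>E = topspace G - V \<and>
     (\<forall>e\<in>E. \<exists>c. characteristic_map G V e c)"

definition is_loop :: "'g topology \<Rightarrow> 'g set \<Rightarrow> 'g set \<Rightarrow> bool" where
  "is_loop G V e \<longleftrightarrow> (\<exists>c. characteristic_map G V e c \<and> c 0 = c 1)"

definition is_reeb_space_of ::
  "'g topology \<Rightarrow> 'g set \<Rightarrow> 'g set set \<Rightarrow>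
   'a topology \<Rightarrow> ('a, 'e::euclidean_space) atlas \<Rightarrow> ('a \<Rightarrow> real) \<Rightarrow> bool" where
  "is_reeb_space_of G V E M A f \<longleftrightarrow>
     (\<exists>h. homeomorphic_map G (reeb_space M f) h \<and>
          h ` V = reeb_vertices M A f \<and>
          (\<lambda>e. h ` e) ` E = reeb_edges M A f)"

end

theory Submission
  imports Defs "HOL-Computational_Algebra.Polynomial"
begin

text \<open>
  For every vertex take a sphere on which the function is constant, the constants being pairwise
  distinct, and for every edge join the spheres of its endpoints by a tube on which the function
  is strictly monotone. The function is thus a height function on the graph composed with the
  map that collapses each punctured sphere to its vertex and each cross-section of a tube to a
  point of its edge. The fibres of this map are connected because \<open>m \<ge> 2\<close>, and since there are no
  loops the height has finite fibres on the graph; so the fibres are exactly the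
  components of the level sets, and by compactness the Reeb space is the graph.

  To have only one kind of transition map, every sphere is the double of a ball, so that both
  doubling and attaching a tube amount to gluing two copies of a round annulus by the inversion
  in its middle sphere.
\<close>

section \<open>Calculus of smooth maps\<close>

text \<open>Whole spheres may be critical, because a vertex only has to be a level component
  containing some critical point. This avoids every case distinction by the numbers of edges going
  up and down at a vertex: isolated vertices, extrema and vertices with one edge on each side are
  treated alike. The price is a transition that is flat to infinite order at both ends of a tube,
  hence the flat exponential. The manifold has to be exhibited with an atlas, so the gluing is
  explicit. All sheets use the same centres, placed on a line so far apart that annuli around
  distinct walls are disjoint. Each inversion preserves its annulus, so a point can cross at most
  one wall and triple overlaps are trivial. The transition takes place where
  \<open>\<bar>lw k x\<bar> < 1\<close>, that is, at distances from the centre between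
  \<open>exp (- 1 / 2)\<close> and \<open>exp (1 / 2)\<close>. This shell lies well inside the
  annulus between \<open>1 / 2\<close> and \<open>2\<close>, so that near the rim of the annulus the
  map to the graph is already constant.\<close>

lemma Ck_on_cong:
  assumes "open S" "\<And>x. x \<in> S \<Longrightarrow> f x = g x" "Ck_on k S f"
  shows "Ck_on k S g"
  using assms(2,3)
proof (induction k arbitrary: f g)
  case 0
  then show ?case using continuous_on_cong[of S S f g] by simp
next
  case (Suc k)
  have "(g has_derivative frechet_derivative f (at x)) (at x)" if "x \<in> S" for x
    using Suc.prems that assms(1)
    by (auto intro: has_derivative_transform_within_open[of f _ x UNIV S]
        simp: frechet_derivative_works)
  then have *: "g differentiable (at x) \<and> frechet_derivative g (at x) = frechet_derivative f (at x)"
    if "x \<in> S" for x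
    using that by (metis differentiableI frechet_derivative_at)
  then show ?case
    using Suc.prems(2) by (auto intro: Suc.IH[of "\<lambda>x. frechet_derivative f (at x) v" for v])
qed

lemma Ck_on_local:
  assumes "\<And>x. x \<in> S \<Longrightarrow> \<exists>T. open T \<and> x \<in> T \<and> Ck_on k T f"
  shows "Ck_on k S f"
  using assms
proof (induction k arbitrary: f)
  case 0
  have "isCont f x" if "x \<in> S" for x
    using 0[OF that] by (auto simp: continuous_on_eq_continuous_at)
  then show ?case
    by (simp add: continuous_at_imp_continuous_on)
next
  case (Suc k)
  have "\<And>v. Ck_on k S (\<lambda>x. frechet_derivative f (at x) v)"
    by (rule Suc.IH) (use Suc.prems in fastforce)
  then show ?case using Suc.prems by fastforce
qed

lemma Ck_on_Suc_D: "Ck_on (Suc k) S f \<Longrightarrow> Ck_on k S f"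
proof (induction k arbitrary: f)
  case 0
  then show ?case
    by (auto intro!: continuous_at_imp_continuous_on differentiable_imp_continuous_within)
next
  case (Suc k)
  then show ?case by simp
qed

text \<open>Trades the abstract \<open>frechet_derivative\<close> for an explicit family
  \<open>D\<close>, so that each closure property becomes an induction on \<open>k\<close> with its
  usual derivative rule.\<close>

lemma Ck_on_SucI:
  assumes "open S" "\<And>x. x \<in> S \<Longrightarrow> (f has_derivative D x) (at x)" "\<And>v. Ck_on k S (\<lambda>x. D x v)"
  shows "Ck_on (Suc k) S f"
proof -
  have "D x = frechet_derivative f (at x)" if "x \<in> S" for x
    using assms(2)[OF that] by (rule frechet_derivative_at)
  then have "Ck_on k S (\<lambda>x. frechet_derivative f (at x) v)" for v
    using assms(3)[of v] by (intro Ck_on_cong[OF assms(1) _ assms(3)[of v]]) simp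
  then show ?thesis using assms(2) by (auto simp: differentiable_def)
qed

lemma Ck_on_SucD:
  assumes "Ck_on (Suc k) S f"
  shows "x \<in> S \<Longrightarrow> (f has_derivative frechet_derivative f (at x)) (at x)"
    and "Ck_on k S (\<lambda>x. frechet_derivative f (at x) v)"
  using assms by (auto simp: frechet_derivative_works)

lemma Ck_on_const: "Ck_on k S (\<lambda>x. c)"
  by (induction k arbitrary: c) (auto)

lemma Ck_on_bounded_linear:
  assumes "open S" "bounded_linear f" shows "Ck_on k S f"
proof (cases k)
  case 0
  then show ?thesis using assms by (simp add: linear_continuous_on)
next
  case (Suc j)
  show ?thesis unfolding Suc
    by (rule Ck_on_SucI[OF assms(1)])
      (auto intro: bounded_linear_imp_has_derivative[OF assms(2)] Ck_on_const)
qed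

lemma Ck_on_add:
  assumes "open S" "Ck_on k S f" "Ck_on k S g" shows "Ck_on k S (\<lambda>x. f x + g x)"
  using assms(2,3)
proof (induction k arbitrary: f g)
  case 0
  then show ?case by (auto intro: continuous_on_add)
next
  case (Suc k)
  note D = Suc.prems[THEN Ck_on_SucD(1)] Suc.prems[THEN Ck_on_SucD(2)]
  show ?case
    by (rule Ck_on_SucI[OF assms(1) has_derivative_add[OF D(1,2)]]) (auto intro: Suc.IH D)
qed

text \<open>The product rule yields two products of the same kind, in which the undifferentiated
  factor is weakened by \<open>Ck_on_Suc_D\<close>. Scalar multiples, real products and inner
  products are all instances.\<close>

lemma (in bounded_bilinear) Ck_on_prod:
  assumes "open S" "Ck_on k S f" "Ck_on k S g" shows "Ck_on k S (\<lambda>x. prod (f x) (g x))"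
  using assms(2,3)
proof (induction k arbitrary: f g)
  case 0
  then show ?case by (auto intro: continuous_on)
next
  case (Suc k)
  note D = Suc.prems[THEN Ck_on_SucD(1)] Suc.prems[THEN Ck_on_SucD(2)]
  show ?case
    by (rule Ck_on_SucI[OF assms(1) FDERIV[OF D(1,2)]])
      (intro Ck_on_add[OF assms(1)] Suc.IH D Suc.prems[THEN Ck_on_Suc_D] | assumption)+
qed

lemmas Ck_on_scaleR = bounded_bilinear.Ck_on_prod[OF bounded_bilinear_scaleR]
lemmas Ck_on_mult = bounded_bilinear.Ck_on_prod[OF bounded_bilinear_mult]
lemmas Ck_on_inner = bounded_bilinear.Ck_on_prod[OF bounded_bilinear_inner]

text \<open>A real outer function has derivative \<open>v * D' y 1\<close>, so the derivative of the
  composite is a product of a derivative of \<open>h\<close> with a composite of the same form. The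
  induction closes with \<open>g\<close> arbitrary. Only \<open>inverse\<close>, \<open>ln\<close>,
  \<open>flat_exp\<close> and \<open>step\<close> are ever composed.\<close>

lemma Ck_on_compose_real:
  fixes g :: "real \<Rightarrow> real" and h :: "'a::real_normed_vector \<Rightarrow> real"
  assumes "open S" "open T" "h ` S \<subseteq> T" "Ck_on k S h" "Ck_on k T g"
  shows "Ck_on k S (\<lambda>x. g (h x))"
  using assms(4,5)
proof (induction k arbitrary: g)
  case 0
  then show ?case using continuous_on_compose2 assms(3) by auto
next
  case (Suc k)
  define D where "D x v = frechet_derivative h (at x) v" for x v
  define D' where "D' y v = frechet_derivative g (at y) v" for y v
  have D: "\<And>x. x \<in> S \<Longrightarrow> (h has_derivative D x) (at x)" "\<And>v. Ck_on k S (\<lambda>x. D x v)"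
    using Ck_on_SucD[OF Suc.prems(1)] by (simp_all add: D_def[abs_def])
  have D': "\<And>y. y \<in> T \<Longrightarrow> (g has_derivative D' y) (at y)" "\<And>v. Ck_on k T (\<lambda>y. D' y v)"
    using Ck_on_SucD[OF Suc.prems(2)] by (simp_all add: D'_def[abs_def])
  have lin: "D' y v = v * D' y 1" if "y \<in> T" for y v
    using linear_cmul[OF has_derivative_linear[OF D'(1)[OF that]], of v 1] by simp
  show ?case
  proof (rule Ck_on_SucI[OF assms(1)])
    show "((\<lambda>x. g (h x)) has_derivative (\<lambda>v. D x v * D' (h x) 1)) (at x)" if "x \<in> S" for x
    proof -
      have "h x \<in> T" using that assms(3) by auto
      then have "(\<lambda>v. D' (h x) (D x v)) = (\<lambda>v. D x v * D' (h x) 1)"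
        by (intro ext lin)
      then show ?thesis
        using has_derivative_compose[OF D(1)[OF that] D'(1)[OF \<open>h x \<in> T\<close>]] by simp
    qed
    show "Ck_on k S (\<lambda>x. D x v * D' (h x) 1)" for v
      by (rule Ck_on_mult[OF assms(1) D(2) Suc.IH[OF Ck_on_Suc_D[OF Suc.prems(1)] D'(2)]])
  qed
qed

lemma Ck_on_SucI_real:
  fixes f :: "real \<Rightarrow> real"
  assumes "open S" "\<And>x. x \<in> S \<Longrightarrow> (f has_real_derivative D x) (at x)" "Ck_on k S D"
  shows "Ck_on (Suc k) S f"
  by (rule Ck_on_SucI[OF assms(1) assms(2)[unfolded has_field_derivative_def]])
    (auto intro!: Ck_on_mult assms Ck_on_const)

text \<open>The derivative is a polynomial in \<open>inverse\<close> itself, so the induction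
  hypothesis applies to it.\<close>

lemma Ck_on_inverse: "Ck_on k {0<..} (inverse :: real \<Rightarrow> real)"
proof (induction k)
  case 0
  then show ?case by (auto intro!: continuous_on_inverse)
next
  case (Suc k)
  show ?case
  proof (rule Ck_on_SucI_real)
    show "(inverse has_real_derivative (-1) * (inverse x * inverse x)) (at x)" if "x \<in> {0<..}" for x :: real
      using that DERIV_inverse[of x] by (simp add: power2_eq_square)
    show "Ck_on k {0<..} (\<lambda>x::real. (-1) * (inverse x * inverse x))"
      by (intro Ck_on_mult Ck_on_const Suc) auto
  qed auto
qed

lemma Ck_on_ln: "Ck_on k {0<..} (ln :: real \<Rightarrow> real)"
proof (cases k)
  case 0
  then show ?thesis by (auto intro!: continuous_on_ln)
next
  case (Suc j)
  show ?thesis unfolding Suc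
    by (rule Ck_on_SucI_real[OF _ _ Ck_on_inverse])
      (auto intro!: DERIV_ln)
qed

lemma Ck_on_norm_square:
  "open S \<Longrightarrow> Ck_on k S (\<lambda>x. (x - a) \<bullet> (x - a))" for a :: "'a::real_inner"
  unfolding diff_conv_add_uminus
  by (intro Ck_on_inner Ck_on_add Ck_on_const) (auto intro: Ck_on_bounded_linear bounded_linear_ident)

section \<open>The flat exponential and a smooth monotone step\<close>

definition flat_exp :: "real \<Rightarrow> real" where
  "flat_exp x = (if x > 0 then exp (- inverse x) else 0)"

lemma flat_exp_pos: "x > 0 \<Longrightarrow> flat_exp x > 0"
  and flat_exp_nonpos: "x \<le> 0 \<Longrightarrow> flat_exp x = 0"
  and flat_exp_nonneg: "flat_exp x \<ge> 0"
  by (auto simp: flat_exp_def)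

lemma tendsto_poly_flat_exp:
  "((\<lambda>x. poly p (inverse x) * exp (- inverse x)) \<longlongrightarrow> (0::real)) (at_right 0)"
proof -
  have 1: "((\<lambda>y. y ^ n * exp (- y)) \<longlongrightarrow> (0::real)) at_top" for n
    using tendsto_power_div_exp_0[of n] by (simp add: exp_minus divide_inverse)
  have "((\<lambda>y. \<Sum>i\<le>degree p. coeff p i * (y ^ i * exp (- y))) \<longlongrightarrow> (\<Sum>i\<le>degree p. coeff p i * (0::real))) at_top"
    by (intro tendsto_intros 1)
  then have "((\<lambda>y. poly p y * exp (- y)) \<longlongrightarrow> (0::real)) at_top"
    by (simp add: poly_altdef sum_distrib_right mult.assoc)
  then show ?thesis
    by (rule filterlim_compose[OF _ filterlim_inverse_at_top_right])
qed

text \<open>Polynomials in \<open>inverse x\<close> are included because this family is closed under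
  differentiation, whereas \<open>flat_exp\<close> alone is not. Smoothness of every order then
  follows by one induction.\<close>

lemma has_derivative_poly_flat_exp:
  fixes p :: "real poly"
  defines "q \<equiv> [:0, 0, 1:] * (p - pderiv p)"
  shows "((\<lambda>x. poly p (inverse x) * flat_exp x) has_real_derivative
     poly q (inverse x) * flat_exp x) (at x)"
proof -
  consider "x > 0" | "x < 0" | "x = 0" by linarith
  then show ?thesis
  proof cases
    case 1
    have "((\<lambda>x. poly p (inverse x) * exp (- inverse x)) has_real_derivative
       poly q (inverse x) * exp (- inverse x)) (at x)"
      using 1 by (auto intro!: derivative_eq_intros DERIV_chain2[OF poly_DERIV]
          simp: q_def algebra_simps power2_eq_square)
    then show ?thesis
      by (rule has_field_derivative_transform_within_open[where S = "{0::real<..}", THEN DERIV_cong])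
        (use 1 in \<open>auto simp: flat_exp_def\<close>)
  next
    case 2
    have "((\<lambda>x. 0) has_real_derivative 0) (at x)" by simp
    then show ?thesis
      by (rule has_field_derivative_transform_within_open[where S = "{..<0}", THEN DERIV_cong])
        (use 2 in \<open>auto simp: flat_exp_def\<close>)
  next
    case 3
    \<comment> \<open>Dividing by \<open>y\<close> in the difference quotient at 0 multiplies the
      polynomial by its variable, so the quotient is covered by the same limit.\<close>
    have "((\<lambda>y. poly ([:0, 1:] * p) (inverse y) * exp (- inverse y)) \<longlongrightarrow> (0::real)) (at_right 0)"
      by (rule tendsto_poly_flat_exp)
    then have "((\<lambda>y. poly p (inverse y) * flat_exp y / y) \<longlongrightarrow> 0) (at_right 0)"
      by (rule Lim_transform_eventually)
        (auto simp: flat_exp_def eventually_at_filter divide_inverse)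
    moreover have "((\<lambda>y. poly p (inverse y) * flat_exp y / y) \<longlongrightarrow> 0) (at_left 0)"
      by (rule Lim_transform_eventually[OF tendsto_const])
        (auto simp: flat_exp_def eventually_at_filter)
    ultimately have "((\<lambda>y. poly p (inverse y) * flat_exp y / y) \<longlongrightarrow> 0) (at 0)"
      by (intro filterlim_split_at)
    then show ?thesis using 3
      by (simp add: has_field_derivative_iff flat_exp_def)
  qed
qed

lemma Ck_on_poly_flat_exp: "Ck_on k UNIV (\<lambda>x. poly p (inverse x) * flat_exp x)"
proof (induction k arbitrary: p)
  case 0
  then show ?case
    by (auto intro!: continuous_at_imp_continuous_on DERIV_isCont[OF has_derivative_poly_flat_exp])
next
  case (Suc k)
  show ?case
    by (rule Ck_on_SucI_real[OF _ has_derivative_poly_flat_exp Suc]) auto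
qed

lemma Ck_on_flat_exp: "Ck_on k UNIV flat_exp"
  using Ck_on_poly_flat_exp[of k 1] by simp

lemma DERIV_flat_exp: "(flat_exp has_real_derivative (inverse x)\<^sup>2 * flat_exp x) (at x)"
  using has_derivative_poly_flat_exp[of 1 x] by (simp add: power2_eq_square pderiv_1)

text \<open>Falls from 1 at \<open>-1\<close> to 0 at \<open>1\<close>. The normalisation is chosen
  for the symmetry \<open>step (- u) = 1 - step u\<close>, which makes the two ends of a tube fit
  together.\<close>

definition step :: "real \<Rightarrow> real" where
  "step u = flat_exp (1 - u) / (flat_exp (1 - u) + flat_exp (1 + u))"

text \<open>The derivative of \<open>step\<close> in factored form: its sign, and hence the critical
  points on a tube, can be read off from the two flat factors.\<close>

definition step' :: "real \<Rightarrow> real" where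
  "step' u = - (((inverse (1 - u))\<^sup>2 + (inverse (1 + u))\<^sup>2) * flat_exp (1 - u) * flat_exp (1 + u))
     / (flat_exp (1 - u) + flat_exp (1 + u))\<^sup>2"

lemma step_denom_pos: "flat_exp (1 - u) + flat_exp (1 + u) > 0"
  using flat_exp_pos[of "1 - u"] flat_exp_pos[of "1 + u"] flat_exp_nonneg[of "1 - u"]
    flat_exp_nonneg[of "1 + u"] by (cases "u < 0") (auto intro: add_pos_nonneg add_nonneg_pos)

lemma DERIV_step: "(step has_real_derivative step' u) (at u)"
proof -
  have 1: "((\<lambda>u. flat_exp (1 - u)) has_real_derivative - ((inverse (1 - u))\<^sup>2 * flat_exp (1 - u))) (at u)"
    using DERIV_chain2[OF DERIV_flat_exp, of "\<lambda>u. 1 - u" "-1" u UNIV] DERIV_diff[OF DERIV_const[of 1] DERIV_ident]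
    by auto
  have 2: "((\<lambda>u. flat_exp (1 + u)) has_real_derivative ((inverse (1 + u))\<^sup>2 * flat_exp (1 + u))) (at u)"
    using DERIV_chain2[OF DERIV_flat_exp, of "\<lambda>u. 1 + u" 1 u UNIV] DERIV_add[OF DERIV_const[of 1] DERIV_ident]
    by auto
  \<comment> \<open>The numerator of the quotient rule, with \<open>p\<close>, \<open>q\<close> for
    the two values of \<open>flat_exp\<close> and \<open>A\<close>, \<open>B\<close> for the squared
    inverses.\<close>
  have "- (A * p) * (p + q) - p * (- (A * p) + B * q) = - ((A + B) * p * q)" for A B p q :: real
    by (simp add: algebra_simps)
  then show ?thesis
    using DERIV_divide[OF 1 DERIV_add[OF 1 2]] step_denom_pos[of u]
    by (simp add: step_def[abs_def] step'_def power2_eq_square)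
qed

lemma Ck_on_step: "Ck_on k UNIV step"
proof -
  have lin: "Ck_on k UNIV (\<lambda>u::real. 1 + c * u)" for c
    by (intro Ck_on_add Ck_on_mult Ck_on_const) (auto intro: Ck_on_bounded_linear bounded_linear_ident)
  have f: "Ck_on k UNIV (\<lambda>u. flat_exp (1 + c * u))" for c
    by (rule Ck_on_compose_real[OF _ _ _ lin Ck_on_flat_exp]) auto
  have s: "Ck_on k UNIV (\<lambda>u. flat_exp (1 + (-1) * u) + flat_exp (1 + 1 * u))"
    by (rule Ck_on_add[OF _ f f]) auto
  have "Ck_on k UNIV (\<lambda>u. inverse (flat_exp (1 + (-1) * u) + flat_exp (1 + 1 * u)))"
    by (rule Ck_on_compose_real[OF _ _ _ s Ck_on_inverse]) (use step_denom_pos in auto)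
  then have "Ck_on k UNIV (\<lambda>u. flat_exp (1 + (-1) * u) * inverse (flat_exp (1 + (-1) * u) + flat_exp (1 + 1 * u)))"
    by (intro Ck_on_mult f) auto
  then show ?thesis by (simp add: step_def[abs_def] divide_inverse)
qed

lemma step_minus: "step (- u) = 1 - step u"
  using step_denom_pos[of u] by (simp add: step_def field_simps)

lemma step_ge: "1 \<le> u \<Longrightarrow> step u = 0"
  by (simp add: step_def flat_exp_nonpos)

lemma step_le: "u \<le> -1 \<Longrightarrow> step u = 1"
  using step_ge[of "- u"] step_minus[of u] by simp

lemma step'_zero: "1 \<le> \<bar>u\<bar> \<Longrightarrow> step' u = 0"
  by (auto simp: step'_def flat_exp_nonpos abs_if split: if_splits)

lemma step'_neg:
  assumes "\<bar>u\<bar> < 1" shows "step' u < 0"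
proof -
  have "0 < 1 - u" "0 < 1 + u" using assms by auto
  then have "0 < (inverse (1 - u))\<^sup>2" "0 < (inverse (1 + u))\<^sup>2" "0 < flat_exp (1 - u)" "0 < flat_exp (1 + u)"
    by (auto intro: flat_exp_pos)
  then have "0 < ((inverse (1 - u))\<^sup>2 + (inverse (1 + u))\<^sup>2) * flat_exp (1 - u) * flat_exp (1 + u)"
    by (meson add_pos_pos mult_pos_pos)
  then show ?thesis
    unfolding step'_def using step_denom_pos[of u] by (intro divide_neg_pos) auto
qed

lemma step_strict_antimono:
  assumes "-1 \<le> u" "u < w" "w \<le> 1" shows "step w < step u"
proof -
  have "\<exists>z>u. z < w \<and> step w - step u = (w - u) * step' z"
    using assms by (intro MVT2) (auto intro: DERIV_step)
  then show ?thesis using assms step'_neg by (smt (verit) mult_pos_neg)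
qed

lemma step_in_iff: "step u \<in> {0<..<1} \<longleftrightarrow> \<bar>u\<bar> < 1"
proof (cases "\<bar>u\<bar> < 1")
  case True
  then show ?thesis
    using step_strict_antimono[of "-1" u] step_strict_antimono[of u 1] step_le[of "-1"] step_ge[of 1]
    by auto
next
  case False
  then show ?thesis
    using step_ge[of u] step_le[of u] by (auto simp: abs_if split: if_splits)
qed

lemma step_range: "0 \<le> step u" "step u \<le> 1"
  using step_denom_pos[of u] flat_exp_nonneg[of "1 - u"] flat_exp_nonneg[of "1 + u"]
  by (auto simp: step_def divide_simps)

lemma continuous_on_step: "continuous_on S step"
  using Ck_on_step[of 0] by (auto intro: continuous_on_subset)

lemma step_surj:
  assumes "s \<in> {0<..<1}" obtains u where "\<bar>u\<bar> < 1" "step u = s"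
proof -
  have "\<exists>u\<ge>-1. u \<le> 1 \<and> step u = s"
    by (rule IVT2') (use assms in \<open>auto simp: step_le step_ge continuous_on_step\<close>)
  then show ?thesis using that assms step_in_iff by metis
qed

lemma step_inj: "\<bar>u\<bar> < 1 \<Longrightarrow> step w = step u \<Longrightarrow> w = u"
  using step_in_iff[of u] step_in_iff[of w] step_strict_antimono[of u w] step_strict_antimono[of w u]
  by (smt (verit))

section \<open>Gluing\<close>

text \<open>Gluing data for a closed manifold: domains \<open>D i\<close>, overlaps and transition
  maps. \<open>separated\<close> says that the gluing relation is closed in each
  \<open>D i \<times> D j\<close>, which gives Hausdorff; the compact sets \<open>core i\<close>
  together meet every class, which gives compactness.\<close>

locale gluing =
  fixes I :: "nat set" and D :: "nat \<Rightarrow> 'e::euclidean_space set"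
    and ov :: "nat \<Rightarrow> nat \<Rightarrow> 'e set" and tr :: "nat \<Rightarrow> nat \<Rightarrow> 'e \<Rightarrow> 'e"
    and core :: "nat \<Rightarrow> 'e set"
  assumes finite_I: "finite I"
    and open_ov: "\<lbrakk>i \<in> I; j \<in> I\<rbrakk> \<Longrightarrow> open (ov i j)"
    and ov_subset: "\<lbrakk>i \<in> I; j \<in> I\<rbrakk> \<Longrightarrow> ov i j \<subseteq> D i"
    and ov_refl: "i \<in> I \<Longrightarrow> ov i i = D i"
    and tr_refl: "\<lbrakk>i \<in> I; x \<in> D i\<rbrakk> \<Longrightarrow> tr i i x = x"
    and tr_in: "\<lbrakk>i \<in> I; j \<in> I; x \<in> ov i j\<rbrakk> \<Longrightarrow> tr i j x \<in> ov j i"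
    and tr_inv: "\<lbrakk>i \<in> I; j \<in> I; x \<in> ov i j\<rbrakk> \<Longrightarrow> tr j i (tr i j x) = x"
    and cocycle: "\<lbrakk>i \<in> I; j \<in> I; k \<in> I; x \<in> ov i j; tr i j x \<in> ov j k\<rbrakk>
        \<Longrightarrow> x \<in> ov i k \<and> tr i k x = tr j k (tr i j x)"
    and smooth_tr: "\<lbrakk>i \<in> I; j \<in> I\<rbrakk> \<Longrightarrow> Ck_on k (ov i j) (tr i j)"
    and separated: "\<lbrakk>i \<in> I; j \<in> I; x \<in> D i; y \<in> D j; \<not> (x \<in> ov i j \<and> tr i j x = y)\<rbrakk>
        \<Longrightarrow> \<exists>X Y. open X \<and> open Y \<and> x \<in> X \<and> y \<in> Y \<and> (\<forall>z \<in> X \<inter> ov i j. tr i j z \<notin> Y)"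
    and core_compact: "i \<in> I \<Longrightarrow> compact (core i)"
    and core_subset: "i \<in> I \<Longrightarrow> core i \<subseteq> D i"
    and core_cover: "\<lbrakk>i \<in> I; x \<in> D i\<rbrakk> \<Longrightarrow> \<exists>j\<in>I. x \<in> ov i j \<and> tr i j x \<in> core j"
begin

text \<open>A point of the glued space is a chosen representative of its class of pairs.\<close>

definition psi :: "nat \<Rightarrow> 'e \<Rightarrow> nat \<times> 'e" where
  "psi i x = (SOME q. fst q \<in> I \<and> x \<in> ov i (fst q) \<and> snd q = tr i (fst q) x)"

definition points :: "(nat \<times> 'e) set" where
  "points = (\<Union>i\<in>I. psi i ` D i)"

definition glued :: "(nat \<times> 'e) topology" where
  "glued = topology (\<lambda>U. U \<subseteq> points \<and> (\<forall>i\<in>I. open {x \<in> D i. psi i x \<in> U}))"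

definition charts :: "(nat \<times> 'e, 'e) atlas" where
  "charts = (\<lambda>i. (psi i ` D i, inv_into (D i) (psi i))) ` I"

lemma open_D: "i \<in> I \<Longrightarrow> open (D i)"
  using open_ov[of i i] ov_refl by simp

lemma psi_rep:
  assumes "i \<in> I" "x \<in> D i"
  obtains k where "k \<in> I" "x \<in> ov i k" "psi i x = (k, tr i k x)"
proof -
  have "\<exists>q. fst q \<in> I \<and> x \<in> ov i (fst q) \<and> snd q = tr i (fst q) x"
    using assms ov_refl by (intro exI[of _ "(i, tr i i x)"]) auto
  from someI_ex[OF this, folded psi_def] show ?thesis
    by (intro that[of "fst (psi i x)"]) (auto simp: prod_eq_iff)
qed

text \<open>Equal values name a common representative in some \<open>D k\<close>, and the cocycle
  condition passes from \<open>i\<close> to \<open>j\<close> through \<open>k\<close>. Conversely,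
  glued points have the same set of candidates.\<close>

lemma psi_eq_iff:
  assumes "i \<in> I" "j \<in> I" "x \<in> D i" "y \<in> D j"
  shows "psi i x = psi j y \<longleftrightarrow> x \<in> ov i j \<and> tr i j x = y"
proof
  assume eq: "psi i x = psi j y"
  obtain k where k: "k \<in> I" "x \<in> ov i k" "psi i x = (k, tr i k x)"
    using psi_rep assms by blast
  obtain l where l: "l \<in> I" "y \<in> ov j l" "psi j y = (l, tr j l y)"
    using psi_rep assms by blast
  have "l = k" and z: "tr i k x = tr j k y" using eq k l by auto
  then have "tr i k x \<in> ov k j" "tr k j (tr i k x) = y"
    using tr_in tr_inv l assms by auto
  then show "x \<in> ov i j \<and> tr i j x = y"
    using cocycle[of i k j x] k assms by auto
next
  assume xy: "x \<in> ov i j \<and> tr i j x = y"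
  then have yx: "y \<in> ov j i" "tr j i y = x"
    using tr_in tr_inv assms by auto
  \<comment> \<open>The two choice predicates coincide, so \<open>SOME\<close> picks the same pair
    for both.\<close>
  have "(k \<in> I \<and> x \<in> ov i k \<and> z = tr i k x) \<longleftrightarrow> (k \<in> I \<and> y \<in> ov j k \<and> z = tr j k y)" for k z
    using cocycle[of i j k x] cocycle[of j i k y] xy yx assms by auto
  then show "psi i x = psi j y"
    unfolding psi_def by (intro arg_cong[of _ _ Eps]) auto
qed

lemma psi_tr: "\<lbrakk>i \<in> I; j \<in> I; x \<in> ov i j\<rbrakk> \<Longrightarrow> psi j (tr i j x) = psi i x"
  using psi_eq_iff[of i j x "tr i j x"] tr_in ov_subset by (metis subsetD)

lemma inj_on_psi: "i \<in> I \<Longrightarrow> inj_on (psi i) (D i)"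
  by (auto simp: inj_on_def psi_eq_iff tr_refl)

lemma inv_psi: "i \<in> I \<Longrightarrow> x \<in> D i \<Longrightarrow> inv_into (D i) (psi i) (psi i x) = x"
  by (simp add: inj_on_psi)

text \<open>The charts are already inverses of the parametrisations \<open>psi i\<close>, and the
  definitions of smoothness and critical points invert them once more; this cancels the double
  inversion.\<close>

lemma inv_into_chart:
  assumes "i \<in> I" "x \<in> D i"
  shows "inv_into (psi i ` D i) (inv_into (D i) (psi i)) x = psi i x"
proof (rule inv_into_f_eq)
  show "inj_on (inv_into (D i) (psi i)) (psi i ` D i)"
    by (simp add: inj_on_inv_into)
qed (use assms inv_psi in auto)

section \<open>Topology and smooth structure of the glued space\<close>

lemma openin_glued:
  "openin glued U \<longleftrightarrow> U \<subseteq> points \<and> (\<forall>i\<in>I. open {x \<in> D i. psi i x \<in> U})"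
proof -
  have "istopology (\<lambda>U. U \<subseteq> points \<and> (\<forall>i\<in>I. open {x \<in> D i. psi i x \<in> U}))"
    unfolding istopology_def
  proof (intro conjI allI impI ballI)
    fix S T i
    assume "S \<subseteq> points \<and> (\<forall>i\<in>I. open {x \<in> D i. psi i x \<in> S})"
      "T \<subseteq> points \<and> (\<forall>i\<in>I. open {x \<in> D i. psi i x \<in> T})" "i \<in> I"
    moreover have "{x \<in> D i. psi i x \<in> S \<inter> T} = {x \<in> D i. psi i x \<in> S} \<inter> {x \<in> D i. psi i x \<in> T}"
      by auto
    ultimately show "open {x \<in> D i. psi i x \<in> S \<inter> T}" by auto
  next
    fix K i
    assume K: "\<forall>U\<in>K. U \<subseteq> points \<and> (\<forall>i\<in>I. open {x \<in> D i. psi i x \<in> U})" and "i \<in> I"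
    have "{x \<in> D i. psi i x \<in> \<Union>K} = (\<Union>U\<in>K. {x \<in> D i. psi i x \<in> U})" by auto
    then show "open {x \<in> D i. psi i x \<in> \<Union>K}" using K \<open>i \<in> I\<close> by auto
  qed auto
  then show ?thesis by (simp add: glued_def topology_inverse')
qed

lemma topspace_glued: "topspace glued = points"
proof -
  have "{x \<in> D i. psi i x \<in> points} = D i" if "i \<in> I" for i
    using that by (auto simp: points_def)
  then have "openin glued points" by (simp add: openin_glued open_D)
  then show ?thesis
    using openin_glued openin_subset openin_topspace by (metis subset_antisym)
qed

lemma psi_in_glued: "i \<in> I \<Longrightarrow> x \<in> D i \<Longrightarrow> psi i x \<in> topspace glued"
  by (auto simp: topspace_glued points_def)

lemma glued_cases:
  assumes "p \<in> topspace glued"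
  obtains i x where "i \<in> I" "x \<in> D i" "p = psi i x"
  using assms by (auto simp: topspace_glued points_def)

text \<open>Seen from sheet \<open>j\<close>, the image is the part of \<open>ov j i\<close> that
  \<open>tr j i\<close> sends into \<open>W\<close>, which is open because the transition maps are
  continuous.\<close>

lemma openin_psi_image:
  assumes "i \<in> I" "open W" "W \<subseteq> D i"
  shows "openin glued (psi i ` W)"
  unfolding openin_glued
proof (intro conjI ballI)
  show "psi i ` W \<subseteq> points" using assms by (auto simp: points_def)
  fix j assume j: "j \<in> I"
  have "x \<in> D j \<and> psi j x \<in> psi i ` W \<longleftrightarrow> x \<in> ov j i \<and> tr j i x \<in> W" for x
  proof -
    have "psi j x = psi i w \<longleftrightarrow> x \<in> ov j i \<and> tr j i x = w" if "w \<in> W" "x \<in> D j" for w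
      using psi_eq_iff[of j i x w] assms j that by blast
    then show ?thesis using ov_subset[OF j assms(1)] unfolding image_iff by blast
  qed
  then have "{x \<in> D j. psi j x \<in> psi i ` W} = ov j i \<inter> tr j i -` W"
    by auto
  moreover have "open (tr j i -` W \<inter> ov j i)"
    using smooth_tr[of j i 0] assms j open_ov[of j i] by (simp add: continuous_on_open_vimage)
  ultimately show "open {x \<in> D j. psi j x \<in> psi i ` W}" by (simp add: Int_commute)
qed

lemma continuous_map_psi:
  assumes "i \<in> I" shows "continuous_map (top_of_set (D i)) glued (psi i)"
  using assms open_D[OF assms]
  by (auto simp: continuous_map_def psi_in_glued openin_glued openin_open_eq)

lemma continuous_map_from_glued:
  assumes "\<And>i. i \<in> I \<Longrightarrow> continuous_map (top_of_set (D i)) Y (\<lambda>x. F (psi i x))"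
  shows "continuous_map glued Y F"
  unfolding continuous_map_def
proof (intro conjI allI impI)
  show "F \<in> topspace glued \<rightarrow> topspace Y"
  proof
    fix p assume "p \<in> topspace glued"
    then obtain i x where "i \<in> I" "x \<in> D i" "p = psi i x" by (rule glued_cases)
    then show "F p \<in> topspace Y"
      using assms[of i] by (auto simp: continuous_map_def Pi_iff)
  qed
  fix U assume U: "openin Y U"
  have "open {x \<in> D i. psi i x \<in> {p \<in> topspace glued. F p \<in> U}}" if "i \<in> I" for i
  proof -
    have "{x \<in> D i. psi i x \<in> {p \<in> topspace glued. F p \<in> U}} = {x \<in> D i. F (psi i x) \<in> U}"
      using that psi_in_glued by auto
    then show ?thesis
      using assms[OF that] U open_D[OF that] by (simp add: continuous_map_def openin_open_eq)
  qed
  then show "openin glued {p \<in> topspace glued. F p \<in> U}"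
    unfolding openin_glued using topspace_glued by auto
qed

lemma homeomorphic_map_psi:
  assumes "i \<in> I"
  shows "homeomorphic_map (top_of_set (D i)) (subtopology glued (psi i ` D i)) (psi i)"
proof (rule bijective_open_imp_homeomorphic_map)
  show "continuous_map (top_of_set (D i)) (subtopology glued (psi i ` D i)) (psi i)"
    using continuous_map_psi[OF assms] by (auto simp: continuous_map_in_subtopology)
  show "open_map (top_of_set (D i)) (subtopology glued (psi i ` D i)) (psi i)"
    unfolding open_map_def
    using openin_psi_image[OF assms] open_D[OF assms]
    by (auto simp: openin_open_eq openin_open_subtopology)
  show "psi i ` topspace (top_of_set (D i)) = topspace (subtopology glued (psi i ` D i))"
    using psi_in_glued[OF assms] by auto
qed (use inj_on_psi assms in auto)

lemma chart_psi:
  assumes "i \<in> I"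
  shows "chart glued (psi i ` D i) (inv_into (D i) (psi i))"
proof -
  have im: "inv_into (D i) (psi i) ` psi i ` D i = D i"
    using inv_psi[OF assms] by (force simp: image_image)
  obtain g where g: "homeomorphic_maps (top_of_set (D i)) (subtopology glued (psi i ` D i)) (psi i) g"
    using homeomorphic_map_psi[OF assms] homeomorphic_map_maps by blast
  then have "homeomorphic_map (subtopology glued (psi i ` D i)) (top_of_set (D i)) g"
    using homeomorphic_maps_map by blast
  moreover have "g q = inv_into (D i) (psi i) q" if "q \<in> topspace (subtopology glued (psi i ` D i))" for q
    using g that inv_psi[OF assms] by (auto simp: homeomorphic_maps_def)
  ultimately have "homeomorphic_map (subtopology glued (psi i ` D i)) (top_of_set (D i)) (inv_into (D i) (psi i))"
    by (rule homeomorphic_map_eq)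
  then show ?thesis
    unfolding chart_def im using openin_psi_image[of i "D i"] open_D assms by auto
qed

lemma Hausdorff_space: "Hausdorff_space glued"
  unfolding Hausdorff_space_def
proof (intro allI impI, elim conjE)
  fix p q assume "p \<in> topspace glued" "q \<in> topspace glued" "p \<noteq> q"
  then obtain i x j y where *: "i \<in> I" "x \<in> D i" "p = psi i x" "j \<in> I" "y \<in> D j" "q = psi j y"
    by (metis glued_cases)
  with \<open>p \<noteq> q\<close> obtain X Y where XY: "open X" "open Y" "x \<in> X" "y \<in> Y"
      "\<forall>z \<in> X \<inter> ov i j. tr i j z \<notin> Y"
    using separated[of i j x y] psi_eq_iff by metis
  have "psi i a \<noteq> psi j b" if "a \<in> X \<inter> D i" "b \<in> Y \<inter> D j" for a b
    using XY(5) * that psi_eq_iff[of i j a b] by auto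
  then have "disjnt (psi i ` (X \<inter> D i)) (psi j ` (Y \<inter> D j))"
    unfolding disjnt_iff by blast
  moreover have "openin glued (psi i ` (X \<inter> D i))" "openin glued (psi j ` (Y \<inter> D j))"
    using XY * open_D by (auto intro!: openin_psi_image)
  ultimately show "\<exists>U V. openin glued U \<and> openin glued V \<and> p \<in> U \<and> q \<in> V \<and> disjnt U V"
    using * XY by blast
qed

lemma second_countable: "second_countable glued"
proof -
  obtain B :: "'e set set" where B: "countable B" "\<And>U. U \<in> B \<Longrightarrow> open U"
    "\<And>S. open S \<Longrightarrow> \<exists>U. U \<subseteq> B \<and> S = \<Union>U"
    using univ_second_countable by blast
  define C where "C = (\<Union>i\<in>I. (\<lambda>W. psi i ` W) ` {W \<in> B. W \<subseteq> D i})"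
  have "countable C"
    unfolding C_def using B(1) finite_I by (auto intro!: countable_finite[THEN countable_UN])
  moreover have "\<forall>V\<in>C. openin glued V"
    using B(2) by (auto simp: C_def intro: openin_psi_image)
  moreover have "\<exists>V\<in>C. p \<in> V \<and> V \<subseteq> U" if U: "openin glued U" "p \<in> U" for U p
  proof -
    obtain i x where i: "i \<in> I" "x \<in> D i" "p = psi i x"
      using U openin_subset glued_cases by (metis subsetD)
    have "open {x \<in> D i. psi i x \<in> U}" using U i by (auto simp: openin_glued)
    then obtain K where K: "K \<subseteq> B" "{x \<in> D i. psi i x \<in> U} = \<Union>K" using B(3) by blast
    then obtain W where "W \<in> K" "x \<in> W" using i U by blast
    then have "W \<in> B" "W \<subseteq> D i" "psi i ` W \<subseteq> U" using K by blast+
    then show ?thesis using i \<open>x \<in> W\<close> by (auto simp: C_def)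
  qed
  ultimately show ?thesis
    unfolding second_countable_def by (intro exI[of _ C]) simp
qed

lemma compact_space: "compact_space glued"
proof -
  have "points = (\<Union>i\<in>I. psi i ` core i)"
  proof
    show "points \<subseteq> (\<Union>i\<in>I. psi i ` core i)"
    proof
      fix p assume "p \<in> points"
      then obtain i x where i: "i \<in> I" "x \<in> D i" "p = psi i x" by (auto simp: points_def)
      then obtain j where "j \<in> I" "x \<in> ov i j" "tr i j x \<in> core j" using core_cover by blast
      then show "p \<in> (\<Union>i\<in>I. psi i ` core i)" using psi_tr[OF i(1) _ _, of j x] i by (intro UN_I[of j] image_eqI[of _ _ "tr i j x"]) auto
    qed
  qed (use core_subset in \<open>auto simp: points_def\<close>)
  moreover have "compactin glued (psi i ` core i)" if "i \<in> I" for i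
    using core_compact[OF that] core_subset[OF that]
    by (intro image_compactin[OF _ continuous_map_psi[OF that]]) (auto simp: compactin_subtopology)
  ultimately show ?thesis
    unfolding compact_space_def topspace_glued using finite_I
    by (auto intro!: compactin_Union)
qed

lemma closed_smooth_manifold: "closed_smooth_manifold glued charts"
proof -
  have "smooth_on (inv_into (D i) (psi i) ` (psi i ` D i \<inter> psi j ` D j))
      (inv_into (D j) (psi j) \<circ> inv_into (psi i ` D i) (inv_into (D i) (psi i)))"
    if ij: "i \<in> I" "j \<in> I" for i j
  proof -
    have "psi i ` D i \<inter> psi j ` D j = psi i ` ov i j"
    proof (intro subset_antisym subsetI)
      fix p assume "p \<in> psi i ` D i \<inter> psi j ` D j"
      then obtain x y where "x \<in> D i" "p = psi i x" "y \<in> D j" "p = psi j y" by blast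
      then have "x \<in> ov i j" using psi_eq_iff[of i j x y] ij by auto
      then show "p \<in> psi i ` ov i j" using \<open>p = psi i x\<close> by blast
    next
      fix p assume "p \<in> psi i ` ov i j"
      then obtain x where x: "x \<in> ov i j" "p = psi i x" by blast
      then have "x \<in> D i" "tr i j x \<in> D j" "p = psi j (tr i j x)"
        using ij ov_subset[OF ij] ov_subset[OF ij(2,1)] tr_in[OF ij] psi_tr[OF ij] by auto
      then show "p \<in> psi i ` D i \<inter> psi j ` D j" using x by blast
    qed
    then have im: "inv_into (D i) (psi i) ` (psi i ` D i \<inter> psi j ` D j) = ov i j"
      using ij ov_subset[of i j] inv_psi[of i] by (force simp: image_image subset_iff)
    have "tr i j x = (inv_into (D j) (psi j) \<circ> inv_into (psi i ` D i) (inv_into (D i) (psi i))) x"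
      if "x \<in> ov i j" for x
    proof -
      have "x \<in> D i" "tr i j x \<in> D j" using that ij ov_subset tr_in by (meson subsetD)+
      then show ?thesis using that ij psi_tr[of i j x] inv_psi[of j "tr i j x"]
        by (simp add: inv_into_chart)
    qed
    then show ?thesis
      unfolding smooth_on_def im using smooth_tr open_ov ij by (blast intro: Ck_on_cong)
  qed
  then show ?thesis
    unfolding closed_smooth_manifold_def smooth_manifold_def
    using Hausdorff_space second_countable compact_space chart_psi
    by (auto simp: charts_def topspace_glued points_def)
qed

lemma chart_image: "i \<in> I \<Longrightarrow> inv_into (D i) (psi i) ` psi i ` D i = D i"
  using inv_psi by (force simp: image_image)

lemma smooth_function:
  assumes "\<And>i k. i \<in> I \<Longrightarrow> Ck_on k (D i) (\<lambda>x. f (psi i x))"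
  shows "smooth_function charts f"
proof -
  have "Ck_on k (D i) (f \<circ> inv_into (psi i ` D i) (inv_into (D i) (psi i)))" if "i \<in> I" for i k
    by (rule Ck_on_cong[OF open_D[OF that] _ assms[OF that]]) (simp add: inv_into_chart that)
  then show ?thesis
    by (auto simp: smooth_function_def charts_def smooth_on_def chart_image)
qed

lemma critical_points:
  "critical_points charts f =
     {psi i x | i x. i \<in> I \<and> x \<in> D i \<and> ((\<lambda>x. f (psi i x)) has_derivative (\<lambda>_. 0)) (at x)}"
proof -
  have *: "((f \<circ> inv_into (psi i ` D i) (inv_into (D i) (psi i))) has_derivative (\<lambda>_. 0)) (at x) \<longleftrightarrow>
      ((\<lambda>x. f (psi i x)) has_derivative (\<lambda>_. 0)) (at x)" if "i \<in> I" "x \<in> D i" for i x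
    by (intro iffI; erule has_derivative_transform_within_open[OF _ open_D[OF that(1)] that(2)])
      (simp_all add: inv_into_chart that(1))
  show ?thesis
  proof (intro subset_antisym subsetI)
    fix p assume "p \<in> critical_points charts f"
    then obtain i where i: "i \<in> I" "p \<in> psi i ` D i"
      "((f \<circ> inv_into (psi i ` D i) (inv_into (D i) (psi i))) has_derivative (\<lambda>_. 0))
         (at (inv_into (D i) (psi i) p))"
      by (auto simp: critical_points_def charts_def)
    then obtain x where x: "x \<in> D i" "p = psi i x" by blast
    then have "((\<lambda>x. f (psi i x)) has_derivative (\<lambda>_. 0)) (at x)"
      using i(3) *[OF i(1) x(1)] by (simp add: inv_psi i(1))
    then show "p \<in> {psi i x | i x. i \<in> I \<and> x \<in> D i \<and> ((\<lambda>x. f (psi i x)) has_derivative (\<lambda>_. 0)) (at x)}"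
      using i x by blast
  next
    fix p assume "p \<in> {psi i x | i x. i \<in> I \<and> x \<in> D i \<and> ((\<lambda>x. f (psi i x)) has_derivative (\<lambda>_. 0)) (at x)}"
    then obtain i x where "i \<in> I" "x \<in> D i" "p = psi i x"
      "((\<lambda>x. f (psi i x)) has_derivative (\<lambda>_. 0)) (at x)" by blast
    then show "p \<in> critical_points charts f"
      unfolding critical_points_def charts_def
      by (intro CollectI bexI[of _ "(psi i ` D i, inv_into (D i) (psi i))"]) (simp_all add: * inv_psi)
  qed
qed

end

section \<open>Reeb spaces via maps to a graph\<close>

lemma characteristic_map_properties:
  assumes "characteristic_map G V e c" "e \<subseteq> topspace G"
  shows "c ` {0<..<1} = e" "inj_on c {0<..<1}" "continuous_map (top_of_set {0..1}) G c"
    "c 0 \<in> V" "c 1 \<in> V"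
  using assms homeomorphic_imp_surjective_map[of "top_of_set {0<..<1}" "subtopology G e" c]
    homeomorphic_imp_injective_map[of "top_of_set {0<..<1}" "subtopology G e" c]
  by (auto simp: characteristic_map_def)

text \<open>The image of the closed interval is compact, hence closed in a Hausdorff space.\<close>

lemma characteristic_map_closure:
  assumes "Hausdorff_space G" "characteristic_map G V e c" "e \<subseteq> topspace G"
  shows "connectedin G e" "closedin G (e \<union> {c 0, c 1})"
proof -
  note c = characteristic_map_properties[OF assms(2,3)]
  have "connectedin (top_of_set {0..1}) {0<..<1::real}"
    by (auto simp: connectedin_subtopology)
  then show "connectedin G e"
    using connectedin_continuous_map_image[OF c(3)] c(1) by metis
  have "compactin G (c ` {0..1})"
    by (rule image_compactin[OF _ c(3)]) (auto simp: compactin_subtopology)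
  moreover have "c ` {0..1} = e \<union> {c 0, c 1}"
    using c(1) by (auto simp: image_iff) (metis atLeastAtMost_iff greaterThanLessThan_iff less_eq_real_def zero_le_one order_refl)+
  ultimately show "closedin G (e \<union> {c 0, c 1})"
    using compactin_imp_closedin[OF assms(1)] by metis
qed

text \<open>The closure of an edge adds only vertices, so edges are closed in the complement of
  \<open>V\<close>. There are finitely many, so each is also open there, and a nonempty connected
  clopen set is a component.\<close>

lemma graph_edges_eq_components:
  assumes "graph G V E"
  shows "connected_components_of (subtopology G (topspace G - V)) = E"
proof -
  have G: "Hausdorff_space G" "finite V" "V \<subseteq> topspace G" "finite E" "disjoint E"
    "\<Union>E = topspace G - V" and ch: "\<And>e. e \<in> E \<Longrightarrow> \<exists>c. characteristic_map G V e c"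
    using assms by (auto simp: graph_def)
  have sub: "e \<subseteq> topspace G - V" if "e \<in> E" for e using G(6) that by auto
  have ne: "e \<noteq> {}" and conn: "connectedin G e" and cl: "closedin G (e \<union> V)" if "e \<in> E" for e
  proof -
    obtain c where c: "characteristic_map G V e c" using ch \<open>e \<in> E\<close> by blast
    have s: "e \<subseteq> topspace G" using sub[OF that] by auto
    show "e \<noteq> {}" using characteristic_map_properties(1)[OF c s] by force
    show "connectedin G e" by (rule characteristic_map_closure[OF G(1) c s])
    have "closedin G V" by (rule closedin_Hausdorff_finite[OF G(1,3,2)])
    then have "closedin G (e \<union> {c 0, c 1} \<union> V)"
      by (intro closedin_Un characteristic_map_closure[OF G(1) c s])
    moreover have "e \<union> {c 0, c 1} \<union> V = e \<union> V"
      using characteristic_map_properties(4,5)[OF c s] by auto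
    ultimately show "closedin G (e \<union> V)" by simp
  qed
  let ?X = "subtopology G (topspace G - V)"
  have cl': "closedin ?X e" if "e \<in> E" for e
    using cl[OF that] sub[OF that] unfolding closedin_subtopology
    by (intro exI[of _ "e \<union> V"]) auto
  then have cl_Union: "closedin ?X (\<Union>(E - {e}))" for e
    using G(4) by (intro closedin_Union) auto
  have op: "openin ?X e" if "e \<in> E" for e
  proof -
    have "topspace ?X = \<Union>E" using G(3,6) by auto
    moreover have "e \<inter> \<Union>(E - {e}) = {}" using G(5) that unfolding disjoint_def by blast
    ultimately have "topspace ?X - \<Union>(E - {e}) = e" using that by blast
    then show ?thesis using openin_diff[OF openin_topspace cl_Union[of e]] by simp
  qed
  have cin: "e \<in> connected_components_of ?X" if e: "e \<in> E" for e
  proof -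
    have c: "connectedin ?X e" using conn[OF e] sub[OF e] by (auto simp: connectedin_subtopology)
    have "?X \<noteq> trivial_topology"
      using connectedin_subset_topspace[OF c] ne[OF e] by (metis subset_empty null_topspace_iff_trivial)
    then obtain C where C: "C \<in> connected_components_of ?X" "e \<subseteq> C"
      using exists_connected_component_of_superset[OF c] by blast
    have "connectedin ?X C" using C connectedin_connected_components_of by blast
    then have "C \<subseteq> e \<or> disjnt C e"
      using connectedin_clopen_cases cl'[OF e] op[OF e] by metis
    then show ?thesis using C ne[OF e] by (auto simp: disjnt_def)
  qed
  moreover have "C \<in> E" if C: "C \<in> connected_components_of ?X" for C
  proof -
    obtain x where "x \<in> C" using nonempty_connected_components_of[OF C] by auto
    then have "x \<in> \<Union>E" using connected_components_of_subset[OF C] G(6) by auto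
    then obtain e where "e \<in> E" "x \<in> e" by auto
    then show ?thesis
      using cin C \<open>x \<in> C\<close> pairwise_disjoint_connected_components_of[of ?X]
      by (metis disjnt_iff pairwiseD)
  qed
  ultimately show ?thesis by auto
qed

lemma connectedin_finite_Hausdorff_eq:
  assumes "connectedin X T" "finite T" "Hausdorff_space X" "a \<in> T" "b \<in> T"
  shows "a = b"
proof (rule ccontr)
  assume "a \<noteq> b"
  have T: "T \<subseteq> topspace X" using assms(1) connectedin_subset_topspace by blast
  then have "closedin X {a}" "closedin X (T - {a})"
    using assms by (auto intro!: closedin_Hausdorff_finite)
  moreover have "T \<subseteq> {a} \<union> (T - {a})" "{a} \<inter> (T - {a}) \<inter> T = {}"
    "{a} \<inter> T \<noteq> {}" "(T - {a}) \<inter> T \<noteq> {}"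
    using assms \<open>a \<noteq> b\<close> by auto
  ultimately show False
    using assms(1) unfolding connectedin_closedin by blast
qed

text \<open>A monotone-light factorisation \<open>f = H \<circ> P\<close>. A connected part of a
  level set has connected image in a finite fibre of \<open>H\<close>, hence a single point;
  conversely each fibre of \<open>P\<close> is connected and lies in one level. So \<open>P\<close>
  and the Reeb projection have the same fibres.\<close>

lemma is_reeb_space_ofI:
  fixes P :: "'a \<Rightarrow> 'g" and H :: "'g \<Rightarrow> real"
  assumes G: "graph G V E" and M: "compact_space M" and P: "continuous_map M G P"
    and surj: "P ` topspace M = topspace G"
    and fib: "\<And>g. g \<in> topspace G \<Longrightarrow> connectedin M {p \<in> topspace M. P p = g}"
    and fin: "\<And>y. finite {g \<in> topspace G. H g = y}"
    and f: "\<And>p. p \<in> topspace M \<Longrightarrow> f p = H (P p)"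
    and crit: "critical_points A f = {p \<in> topspace M. P p \<in> V}"
  shows "is_reeb_space_of G V E M A f"
proof -
  have haus: "Hausdorff_space G" and V: "V \<subseteq> topspace G" using G by (auto simp: graph_def)
  define h where "h g = {p \<in> topspace M. P p = g}" for g
  have rel: "(p, q) \<in> reeb_rel M f \<longleftrightarrow> p \<in> topspace M \<and> q \<in> topspace M \<and> P p = P q" for p q
  proof
    assume pq: "(p, q) \<in> reeb_rel M f"
    then obtain T where T: "connectedin (subtopology M {x \<in> topspace M. f x = f p}) T" "p \<in> T" "q \<in> T"
      by (auto simp: reeb_rel_def connected_component_of_def)
    then have "connectedin M T" and TM: "T \<subseteq> {x \<in> topspace M. f x = f p}"
      by (auto simp: connectedin_subtopology)
    then have con: "connectedin G (P ` T)" by (intro connectedin_continuous_map_image[OF P])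
    have "P ` T \<subseteq> {g \<in> topspace G. H g = f p}"
      using TM f surj by auto
    then have "finite (P ` T)" using fin finite_subset by blast
    then have "P p = P q"
      using connectedin_finite_Hausdorff_eq[OF con _ haus] T by blast
    then show "p \<in> topspace M \<and> q \<in> topspace M \<and> P p = P q" using T TM by auto
  next
    assume pq: "p \<in> topspace M \<and> q \<in> topspace M \<and> P p = P q"
    then have "P p \<in> topspace G" using surj by auto
    have "connectedin (subtopology M {x \<in> topspace M. f x = f p}) {x \<in> topspace M. P x = P p}"
      using fib[OF \<open>P p \<in> topspace G\<close>] f pq by (auto simp: connectedin_subtopology)
    then have "connected_component_of (subtopology M {x \<in> topspace M. f x = f p}) p q"
      unfolding connected_component_of_def using pq by force
    then show "(p, q) \<in> reeb_rel M f" using pq f by (auto simp: reeb_rel_def)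
  qed
  have proj: "reeb_proj M f p = h (P p)" if "p \<in> topspace M" for p
    using that by (auto simp: reeb_proj_def h_def rel)
  \<comment> \<open>A continuous surjection from a compact space to a Hausdorff space is a quotient
    map. As \<open>h \<circ> P\<close> is the Reeb projection, also a quotient map, the bijection
    \<open>h\<close> is a homeomorphism.\<close>
  have qP: "quotient_map M G P"
    by (rule continuous_imp_quotient_map[OF P M haus surj])
  have qh: "quotient_map M (reeb_space M f) (h \<circ> P)"
    using quotient_map_reeb_proj by (rule quotient_map_eq) (simp add: proj)
  have "quotient_map G (reeb_space M f) h"
    using quotient_map_compose_eq[OF qP] qh by blast
  moreover have inj: "inj_on h (topspace G)"
    unfolding inj_on_def h_def using surj by (auto simp: image_iff set_eq_iff) (metis imageE surj)
  ultimately have homeo: "homeomorphic_map G (reeb_space M f) h"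
    by (simp add: homeomorphic_map_def)
  have top: "topspace (reeb_space M f) = h ` topspace G"
    using homeomorphic_imp_surjective_map[OF homeo] by simp
  have vert: "h ` V = reeb_vertices M A f"
  proof -
    have *: "h g \<inter> critical_points A f \<noteq> {} \<longleftrightarrow> g \<in> V" if g: "g \<in> topspace G" for g
    proof -
      obtain p where "p \<in> topspace M" "P p = g" using g surj by (metis imageE)
      then show ?thesis unfolding h_def crit by blast
    qed
    show ?thesis
      unfolding reeb_vertices_def top using V * by blast
  qed
  have "h ` (topspace G - V) = topspace (reeb_space M f) - reeb_vertices M A f"
    unfolding vert[symmetric] top using inj V by (simp add: inj_on_image_set_diff)
  then have "homeomorphic_map (subtopology G (topspace G - V))
      (subtopology (reeb_space M f) (topspace (reeb_space M f) - reeb_vertices M A f)) h"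
    by (intro homeomorphic_map_subtopologies[OF homeo]) (simp add: Int_absorb1)
  from homeomorphic_map_connected_components_of[OF this]
  have "(\<lambda>e. h ` e) ` E = reeb_edges M A f"
    unfolding reeb_edges_def graph_edges_eq_components[OF G] by (rule sym)
  with homeo vert show ?thesis unfolding is_reeb_space_of_def by blast
qed

section \<open>Spheres joined by tubes\<close>

text \<open>
  Sheet \<open>i < n\<close> belongs to vertex \<open>i\<close> and sheet \<open>n + i\<close> is the other half of its doubled ball of
  radius \<open>R\<close>. Wall \<open>w < K\<close> is the unit sphere used by edge \<open>w\<close> in the sheets of both its endpoints
  \<open>a w\<close> and \<open>b w\<close>; wall \<open>K\<close> is the sphere of radius \<open>R\<close> along which every ball is doubled.
  Sheets not incident with a wall are fixed by \<open>partner\<close> and ignore the wall. Every sheet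
  extends past its walls up to the far side of the surrounding annulus.
\<close>

locale sheets =
  fixes n K :: nat and a b :: "nat \<Rightarrow> nat" and d :: "'e::euclidean_space"
  assumes ends: "k < K \<Longrightarrow> a k < n" "k < K \<Longrightarrow> b k < n" "k < K \<Longrightarrow> a k \<noteq> b k"
    and norm_d: "norm d = 1"
begin

section \<open>Geometry of the walls, annuli and sheets\<close>

definition R :: real where "R = 10 * real K + 10"

text \<open>Spacing 5 exceeds twice the outer radius 2 of an inner annulus, and \<open>R\<close> is
  so large that the balls of radius 2 about the inner centres stay within norm \<open>R / 2\<close>,
  the inner radius of the annulus around the doubling wall.\<close>

definition cen :: "nat \<Rightarrow> 'e" where "cen w = (if w < K then (5 * real w) *\<^sub>R d else 0)"

definition rad :: "nat \<Rightarrow> real" where "rad w = (if w < K then 1 else R)"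

definition partner :: "nat \<Rightarrow> nat \<Rightarrow> nat" where
  "partner w i =
     (if w < K then if i = a w then b w else if i = b w then a w else i
      else if i < n then n + i else i - n)"

definition inversion :: "nat \<Rightarrow> 'e \<Rightarrow> 'e" where
  "inversion w x = cen w + ((rad w)\<^sup>2 * inverse ((x - cen w) \<bullet> (x - cen w))) *\<^sub>R (x - cen w)"

text \<open>The inversion exchanges the radii \<open>rad w / 2\<close> and \<open>2 * rad w\<close>,
  so it preserves this annulus.\<close>

definition ann :: "nat \<Rightarrow> 'e set" where
  "ann w = {x. rad w / 2 < norm (x - cen w) \<and> norm (x - cen w) < 2 * rad w}"

text \<open>The wall is read off from the point and not from the pair of sheets, since parallel
  edges join the same two sheets along several walls.\<close>

definition wall :: "'e \<Rightarrow> nat" where "wall x = (THE w. w \<le> K \<and> x \<in> ann w)"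

abbreviation Ix :: "nat set" where "Ix \<equiv> {..<2 * n}"

definition dm :: "nat \<Rightarrow> 'e set" where
  "dm i = {x. norm x < 2 * R \<and> (\<forall>w<K. partner w i \<noteq> i \<longrightarrow> 1 / 2 < norm (x - cen w))}"

definition ov :: "nat \<Rightarrow> nat \<Rightarrow> 'e set" where
  "ov i j = (if i = j then dm i else \<Union>w\<in>{w. w \<le> K \<and> partner w i = j}. ann w)"

definition tr :: "nat \<Rightarrow> nat \<Rightarrow> 'e \<Rightarrow> 'e" where
  "tr i j x = (if i = j then x else inversion (wall x) x)"

text \<open>The part of a sheet on its own side of all its walls. What lies beyond a wall is covered
  by the core of the partner.\<close>

definition core :: "nat \<Rightarrow> 'e set" where
  "core i = {x. norm x \<le> R \<and> (\<forall>w<K. partner w i \<noteq> i \<longrightarrow> 1 \<le> norm (x - cen w))}"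

lemma R_ge: "R \<ge> 10" by (simp add: R_def)

lemma rad_pos: "rad w > 0" using R_ge by (simp add: rad_def)

lemma norm_cen: "w < K \<Longrightarrow> norm (cen w) \<le> R / 2 - 10"
  by (simp add: cen_def R_def norm_d)

text \<open>Source of all statements that distinct walls do not interfere: whatever happens near one
  centre is far from the other centres and from the doubling wall.\<close>

lemma near_far:
  assumes "w < K" "norm (x - cen w) \<le> 2"
  shows "norm x < R / 2" "w' < K \<Longrightarrow> w' \<noteq> w \<Longrightarrow> 3 \<le> norm (x - cen w')"
proof -
  show "norm x < R / 2"
    using norm_cen[OF assms(1)] assms(2) norm_triangle_sub[of x "cen w"] by linarith
  assume w': "w' < K" "w' \<noteq> w"
  have "cen w - cen w' = (5 * (real w - real w')) *\<^sub>R d"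
    using assms w' by (simp add: cen_def algebra_simps)
  then have "norm (cen w - cen w') = 5 * \<bar>real w - real w'\<bar>"
    by (simp only: norm_scaleR norm_d mult_1_right abs_mult abs_numeral)
  moreover have "\<bar>real w - real w'\<bar> \<ge> 1" using w' by linarith
  ultimately have "5 \<le> norm (cen w - cen w')" by simp
  moreover have "norm (cen w - cen w') \<le> norm (x - cen w) + norm (x - cen w')"
    by (metis dist_commute dist_norm dist_triangle2 norm_minus_commute)
  ultimately show "3 \<le> norm (x - cen w')" using assms(2) by linarith
qed

lemma far_outer: "R / 2 \<le> norm x \<Longrightarrow> w < K \<Longrightarrow> 2 < norm (x - cen w)"
  using near_far(1)[of w x] by force

lemma ann_inner: "w < K \<Longrightarrow> x \<in> ann w \<longleftrightarrow> 1 / 2 < norm (x - cen w) \<and> norm (x - cen w) < 2"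
  by (simp add: ann_def rad_def)

lemma ann_outer: "x \<in> ann K \<longleftrightarrow> R / 2 < norm x \<and> norm x < 2 * R"
  by (simp add: ann_def rad_def cen_def)

lemma ann_unique:
  assumes "w \<le> K" "w' \<le> K" "x \<in> ann w" "x \<in> ann w'" shows "w = w'"
proof -
  have *: "w = w'" if "w \<le> K" "w' < K" "x \<in> ann w" "x \<in> ann w'" for w w'
  proof (cases "w = K")
    case True
    then show ?thesis using that far_outer[of x w'] by (auto simp: ann_inner ann_outer)
  next
    case False
    then show ?thesis using that near_far(2)[of w x w'] by (force simp: ann_inner)
  qed
  show ?thesis
    using *[of w w'] *[of w' w] assms by (cases "w' < K"; cases "w < K") auto
qed

lemma wall_eq: "w \<le> K \<Longrightarrow> x \<in> ann w \<Longrightarrow> wall x = w"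
  unfolding wall_def using ann_unique by blast

lemma norm_inversion: "norm (inversion w x - cen w) = (rad w)\<^sup>2 / norm (x - cen w)"
proof -
  have "norm (inversion w x - cen w) = \<bar>(rad w)\<^sup>2 * inverse ((norm (x - cen w))\<^sup>2)\<bar> * norm (x - cen w)"
    by (simp only: inversion_def add_diff_cancel_left' norm_scaleR dot_square_norm)
  also have "\<dots> = (rad w)\<^sup>2 / norm (x - cen w)"
    by (cases "x = cen w") (auto simp: abs_mult power2_eq_square divide_simps)
  finally show ?thesis .
qed

lemma inversion_inversion:
  assumes "x \<noteq> cen w" shows "inversion w (inversion w x) = x"
proof -
  let ?N = "(x - cen w) \<bullet> (x - cen w)"
  have N: "?N \<noteq> 0" using assms by simp
  have "inversion w x - cen w = ((rad w)\<^sup>2 * inverse ?N) *\<^sub>R (x - cen w)"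
    by (simp add: inversion_def)
  then have "inversion w (inversion w x) = cen w +
     ((rad w)\<^sup>2 * inverse (((rad w)\<^sup>2 * inverse ?N) * (((rad w)\<^sup>2 * inverse ?N) * ?N))
       * ((rad w)\<^sup>2 * inverse ?N)) *\<^sub>R (x - cen w)"
    unfolding inversion_def[of w "inversion w x"] by simp
  also have "(rad w)\<^sup>2 * inverse (((rad w)\<^sup>2 * inverse ?N) * (((rad w)\<^sup>2 * inverse ?N) * ?N))
       * ((rad w)\<^sup>2 * inverse ?N) = 1"
    using N rad_pos[of w] by (simp add: field_simps)
  finally show ?thesis by simp
qed

lemma ann_not_cen: "x \<in> ann w \<Longrightarrow> x \<noteq> cen w"
  using rad_pos[of w] by (auto simp: ann_def)

lemma inversion_ann:
  assumes "x \<in> ann w" shows "inversion w x \<in> ann w" "inversion w (inversion w x) = x"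
proof -
  have "norm (x - cen w) > 0" using ann_not_cen[OF assms] by simp
  then show "inversion w x \<in> ann w"
    using assms rad_pos[of w] by (simp add: ann_def norm_inversion power2_eq_square field_simps)
qed (rule inversion_inversion[OF ann_not_cen[OF assms]])

lemma open_ann: "open (ann w)"
  unfolding ann_def by (intro open_Collect_conj open_Collect_less continuous_intros)

lemma open_dm: "open (dm i)"
proof -
  have "dm i = {x. norm x < 2 * R} \<inter> (\<Inter>w\<in>{w. w < K \<and> partner w i \<noteq> i}. {x. 1 / 2 < norm (x - cen w)})"
    by (auto simp: dm_def)
  then show ?thesis
    by (auto intro!: open_Int open_INT open_Collect_less continuous_intros)
qed

lemma ann_subset_dm: "w \<le> K \<Longrightarrow> ann w \<subseteq> dm i"
proof
  fix x assume w: "w \<le> K" and x: "x \<in> ann w"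
  show "x \<in> dm i"
  proof (cases "w = K")
    case True
    then show ?thesis using x far_outer[of x] by (force simp: dm_def ann_outer)
  next
    case False
    with w x have "w < K" "1 / 2 < norm (x - cen w)" "norm (x - cen w) < 2" by (auto simp: ann_inner)
    then show ?thesis
      using near_far[of w x] R_ge by (fastforce simp: dm_def)
  qed
qed

lemma partner_in: "i \<in> Ix \<Longrightarrow> partner w i \<in> Ix"
  using ends[of w] by (auto simp: partner_def)

lemma partner_partner: "i \<in> Ix \<Longrightarrow> partner w (partner w i) = i"
  using ends[of w] by (auto simp: partner_def)

lemma partner_outer: "i \<in> Ix \<Longrightarrow> partner K i \<noteq> i"
  by (auto simp: partner_def)

lemma ovE:
  assumes "x \<in> ov i j" "i \<noteq> j"
  obtains w where "w \<le> K" "partner w i = j" "x \<in> ann w" "tr i j x = inversion w x"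
  using assms that by (auto simp: ov_def tr_def wall_eq)

lemma ovI: "w \<le> K \<Longrightarrow> partner w i = j \<Longrightarrow> i \<noteq> j \<Longrightarrow> x \<in> ann w \<Longrightarrow> x \<in> ov i j"
  by (auto simp: ov_def)

lemma trI: "w \<le> K \<Longrightarrow> i \<noteq> j \<Longrightarrow> x \<in> ann w \<Longrightarrow> tr i j x = inversion w x"
  by (simp add: tr_def wall_eq)

lemma smooth_inversion: "Ck_on k (ann w) (inversion w)"
proof -
  have "Ck_on k (ann w) (\<lambda>x. inverse ((x - cen w) \<bullet> (x - cen w)))"
    by (rule Ck_on_compose_real[OF open_ann _ _ Ck_on_norm_square[OF open_ann] Ck_on_inverse])
      (auto dest: ann_not_cen)
  then show ?thesis
    unfolding inversion_def[abs_def] diff_conv_add_uminus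
    by (intro Ck_on_add Ck_on_scaleR Ck_on_mult Ck_on_const open_ann
        Ck_on_bounded_linear[OF open_ann bounded_linear_ident]) simp_all
qed

text \<open>This is what makes the glued space Hausdorff: inside \<open>dm i \<times> dm j\<close> the gluing relation agrees
  with the compact graphs of the inversions over the closed annuli.\<close>

lemma closed_inversion_graph:
  "closed {(x, y). rad w / 2 \<le> norm (x - cen w) \<and> norm (x - cen w) \<le> 2 * rad w \<and> y = inversion w x}"
proof -
  let ?S = "{x. rad w / 2 \<le> norm (x - cen w) \<and> norm (x - cen w) \<le> 2 * rad w}"
  have "closed ?S"
    by (intro closed_Collect_conj closed_Collect_le continuous_intros)
  moreover have "bounded ?S"
    unfolding bounded_def by (intro exI[of _ "cen w"] exI[of _ "2 * rad w"]) (auto simp: dist_norm norm_minus_commute)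
  ultimately have "compact ?S" by (simp add: compact_eq_bounded_closed)
  moreover have "continuous_on ?S (\<lambda>x. (x, inversion w x))"
    unfolding inversion_def using rad_pos[of w] by (intro continuous_intros) auto
  ultimately have "compact ((\<lambda>x. (x, inversion w x)) ` ?S)"
    by (rule compact_continuous_image[rotated])
  moreover have "(\<lambda>x. (x, inversion w x)) ` ?S =
     {(x, y). rad w / 2 \<le> norm (x - cen w) \<and> norm (x - cen w) \<le> 2 * rad w \<and> y = inversion w x}"
    by auto
  ultimately have "compact {(x, y). rad w / 2 \<le> norm (x - cen w) \<and> norm (x - cen w) \<le> 2 * rad w
      \<and> y = inversion w x}"
    by simp
  then show ?thesis by (rule compact_imp_closed)
qed

text \<open>A domain cuts an annulus off on one side only: at the inner radius for an edge wall, at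
  the outer radius for the doubling wall. The other bound has to come from the partner
  sheet.\<close>

lemma dm_norm_gt:
  assumes "w \<le> K" "partner w i \<noteq> i" "x \<in> dm i" "norm (x - cen w) \<le> 2 * rad w"
  shows "w < K \<Longrightarrow> rad w / 2 < norm (x - cen w)" "w = K \<Longrightarrow> norm (x - cen w) < 2 * rad w"
  using assms by (auto simp: dm_def rad_def cen_def)

lemma separated:
  assumes ij: "i \<in> Ix" "j \<in> Ix" and xy: "x \<in> dm i" "y \<in> dm j" "\<not> (x \<in> ov i j \<and> tr i j x = y)"
  shows "\<exists>X Y. open X \<and> open Y \<and> x \<in> X \<and> y \<in> Y \<and> (\<forall>z \<in> X \<inter> ov i j. tr i j z \<notin> Y)"
proof (cases "i = j")
  case True
  then have "x \<noteq> y" using xy by (auto simp: ov_def tr_def)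
  from hausdorff[OF this] obtain X Y where "open X" "open Y" "x \<in> X" "y \<in> Y" "X \<inter> Y = {}"
    by auto
  then show ?thesis using True by (intro exI[of _ X] exI[of _ Y]) (auto simp: tr_def)
next
  case False
  define Gr where "Gr w = {(x, y). rad w / 2 \<le> norm (x - cen w) \<and> norm (x - cen w) \<le> 2 * rad w
      \<and> y = inversion w x}" for w
  let ?C = "\<Union>w\<in>{w. w \<le> K \<and> partner w i = j}. Gr w"
  have "closed ?C"
    unfolding Gr_def by (intro closed_UN closed_inversion_graph ballI) auto
  moreover have "(x, y) \<notin> ?C"
  proof
    assume "(x, y) \<in> ?C"
    then obtain w where w: "w \<le> K" "partner w i = j" "rad w / 2 \<le> norm (x - cen w)"
      "norm (x - cen w) \<le> 2 * rad w" "y = inversion w x"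
      by (auto simp: Gr_def)
    have pos: "norm (x - cen w) > 0" using w(3) rad_pos[of w] by linarith
    \<comment> \<open>The distances of a point and of its inverse from the centre multiply to the
      square of \<open>rad w\<close>, so the strict bound that \<open>dm j\<close> puts on
      \<open>y\<close> becomes the missing bound on \<open>x\<close>.\<close>
    have y: "norm (y - cen w) * norm (x - cen w) = (rad w)\<^sup>2"
      using pos by (simp add: w(5) norm_inversion)
    have pj: "partner w j \<noteq> j" using partner_partner[OF ij(1), of w] w(2) False by simp
    have yle: "norm (y - cen w) \<le> 2 * rad w"
      using w(3) pos rad_pos[of w] by (simp add: w(5) norm_inversion field_simps power2_eq_square)
    have "x \<in> ann w"
    proof (cases "w = K")
      case True
      have "norm (x - cen w) < 2 * rad w"
        using dm_norm_gt(2)[OF w(1) _ xy(1) w(4)] True False w by auto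
      moreover have "norm (y - cen w) < 2 * rad w"
        using dm_norm_gt(2)[OF w(1) pj xy(2) yle] True by auto
      then have "(rad w)\<^sup>2 < 2 * rad w * norm (x - cen w)"
        using y pos by (metis mult_less_cancel_right_pos)
      then have "rad w / 2 < norm (x - cen w)"
        using rad_pos[of w] by (simp add: power2_eq_square)
      ultimately show ?thesis by (simp add: ann_def)
    next
      case less: False
      have 1: "rad w / 2 < norm (x - cen w)"
        using dm_norm_gt(1)[OF w(1) _ xy(1) w(4)] False w less by auto
      have "rad w / 2 < norm (y - cen w)"
        using dm_norm_gt(1)[OF w(1) pj xy(2) yle] less w by auto
      then have "rad w / 2 * norm (x - cen w) < (rad w)\<^sup>2"
        using y pos by (metis mult_less_cancel_right_pos)
      then have "norm (x - cen w) < 2 * rad w"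
        using rad_pos[of w] by (simp add: power2_eq_square)
      with 1 show ?thesis by (simp add: ann_def)
    qed
    then show False using xy(3) ovI[OF w(1,2) False] trI[OF w(1) False] w(5) by auto
  qed
  ultimately have "open (- ?C)" "(x, y) \<in> - ?C" by (simp_all only: open_Compl Compl_iff not_False_eq_True)
  then obtain X Y where XY: "open X" "open Y" "(x, y) \<in> X \<times> Y" "X \<times> Y \<subseteq> - ?C"
    by (rule open_prod_elim)
  have "tr i j z \<notin> Y" if z: "z \<in> X \<inter> ov i j" for z
  proof
    assume "tr i j z \<in> Y"
    obtain w where w: "w \<le> K" "partner w i = j" "z \<in> ann w" "tr i j z = inversion w z"
      using z False by (auto elim: ovE)
    then have "(z, tr i j z) \<in> ?C" by (auto simp: Gr_def ann_def)
    then show False using XY(4) z \<open>tr i j z \<in> Y\<close> by blast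
  qed
  then show ?thesis using XY by blast
qed

lemma compact_core: "compact (core i)"
proof -
  have "core i = cball 0 R \<inter> (\<Inter>w\<in>{w. w < K \<and> partner w i \<noteq> i}. {x. 1 \<le> norm (x - cen w)})"
    by (auto simp: core_def)
  then show ?thesis
    by (auto intro!: compact_Int_closed closed_INT closed_Collect_le continuous_intros)
qed

text \<open>A point outside its core lies beyond one wall, and the inversion brings it back. Its
  image stays in the same annulus and is therefore clear of all other walls.\<close>

lemma core_cover:
  assumes i: "i \<in> Ix" and x: "x \<in> dm i"
  shows "\<exists>j\<in>Ix. x \<in> ov i j \<and> tr i j x \<in> core j"
proof -
  consider "x \<in> core i" | "R < norm x" | w where "w < K" "partner w i \<noteq> i" "norm (x - cen w) < 1"
    by (fastforce simp: core_def)
  then show ?thesis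
  proof cases
    case 1
    then show ?thesis using i x by (intro bexI[of _ i]) (auto simp: ov_def tr_def)
  next
    case 2
    then have xa: "x \<in> ann K" using x R_ge by (auto simp: ann_outer dm_def)
    let ?j = "partner K i"
    have y: "inversion K x \<in> ann K" using inversion_ann xa by blast
    have "norm (inversion K x) = R\<^sup>2 / norm x"
      using norm_inversion[of K x] by (simp add: cen_def rad_def)
    then have "norm (inversion K x) \<le> R"
      using 2 R_ge mult_left_mono[of R "norm x" R] by (simp add: power2_eq_square divide_le_eq)
    moreover have "2 < norm (inversion K x - cen w)" if "w < K" for w
      using far_outer[of "inversion K x" w] y that by (auto simp: ann_outer)
    ultimately have "inversion K x \<in> core ?j" by (force simp: core_def)
    then show ?thesis
      using xa partner_in[OF i] partner_outer[OF i] trI[of K i ?j x] ovI[of K i ?j x]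
      by (intro bexI[of _ ?j]) auto
  next
    case 3
    then have xa: "x \<in> ann w" using x by (auto simp: ann_inner dm_def)
    let ?j = "partner w i"
    have y: "inversion w x \<in> ann w" using inversion_ann xa by blast
    then have y2: "norm (inversion w x - cen w) \<le> 2" using 3 by (auto simp: ann_inner)
    have "0 < norm (x - cen w)" using ann_not_cen[OF xa] by simp
    then have "1 \<le> norm (inversion w x - cen w)"
      using 3 norm_inversion[of w x] by (simp add: rad_def)
    then have "inversion w x \<in> core ?j"
      using near_far[OF 3(1) y2] R_ge by (force simp: core_def)
    then show ?thesis
      using xa partner_in[OF i] 3 trI[of w i ?j x] ovI[of w i ?j x]
      by (intro bexI[of _ ?j]) auto
  qed
qed

sublocale gluing Ix dm ov tr core
proof
  fix i j assume ij: "i \<in> Ix" "j \<in> Ix"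
  show "open (ov i j)" by (auto simp: ov_def open_dm open_ann)
  show "ov i j \<subseteq> dm i" using ann_subset_dm by (auto simp: ov_def)
  show "Ck_on k (ov i j) (tr i j)" for k
  proof (cases "i = j")
    case True
    then show ?thesis
      by (simp add: tr_def[abs_def] ov_def Ck_on_bounded_linear open_dm bounded_linear_ident)
  next
    case False
    show ?thesis
    proof (rule Ck_on_local)
      fix x assume "x \<in> ov i j"
      then obtain w where w: "w \<le> K" "partner w i = j" "x \<in> ann w"
        using False by (rule ovE)
      have "Ck_on k (ann w) (tr i j)"
        by (rule Ck_on_cong[OF open_ann _ smooth_inversion]) (rule trI[OF w(1) False, symmetric])
      then show "\<exists>T. open T \<and> x \<in> T \<and> Ck_on k T (tr i j)" using open_ann w by blast
    qed
  qed
  show "tr i j x \<in> ov j i" "tr j i (tr i j x) = x" if x: "x \<in> ov i j" for x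
  proof -
    have "tr i j x \<in> ov j i \<and> tr j i (tr i j x) = x"
    proof (cases "i = j")
      case True
      then show ?thesis using x by (simp add: tr_def)
    next
      case False
      obtain w where w: "w \<le> K" "partner w i = j" "x \<in> ann w" "tr i j x = inversion w x"
        using x False by (rule ovE)
      then show ?thesis
        using False inversion_ann[OF w(3)] partner_partner[OF ij(1), of w]
        by (auto simp: trI intro: ovI)
    qed
    then show "tr i j x \<in> ov j i" "tr j i (tr i j x) = x" by auto
  qed
next
  fix i j k x assume ijk: "i \<in> Ix" "j \<in> Ix" "k \<in> Ix" and x: "x \<in> ov i j" "tr i j x \<in> ov j k"
  show "x \<in> ov i k \<and> tr i k x = tr j k (tr i j x)"
  proof (cases "i = j \<or> j = k")
    case True
    then show ?thesis using x by (auto simp: tr_def)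
  next
    case False
    obtain w where w: "w \<le> K" "partner w i = j" "x \<in> ann w" "tr i j x = inversion w x"
      using x(1) False by (auto elim: ovE)
    obtain w' where w': "w' \<le> K" "partner w' j = k" "inversion w x \<in> ann w'"
        "tr j k (tr i j x) = inversion w' (inversion w x)"
      using x(2) False w by (auto elim!: ovE)
    \<comment> \<open>After the first crossing the point is still in the annulus of
      \<open>w\<close>, so the second crossing uses the same wall and leads back to sheet
      \<open>i\<close>.\<close>
    have "w' = w" using ann_unique w w' inversion_ann by blast
    then have "k = i" using w w' partner_partner[OF ijk(1), of w] by simp
    then show ?thesis
      using w w' \<open>w' = w\<close> inversion_ann[OF w(3)] ann_subset_dm[OF w(1)] by (auto simp: ov_def tr_def)
  qed
next
  fix i assume "i \<in> Ix"
  show "core i \<subseteq> dm i" using R_ge by (force simp: core_def dm_def)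
next
  fix i j x y
  assume "i \<in> Ix" "j \<in> Ix" "x \<in> dm i" "y \<in> dm j" "\<not> (x \<in> ov i j \<and> tr i j x = y)"
  then show "\<exists>X Y. open X \<and> open Y \<and> x \<in> X \<and> y \<in> Y \<and> (\<forall>z \<in> X \<inter> ov i j. tr i j z \<notin> Y)"
    by (rule separated)
qed (simp_all add: ov_def[of i i for i] tr_def[of i i for i] compact_core core_cover)

end

section \<open>The map to the graph and the height\<close>

locale sheets_over_graph = sheets n K a b d
  for n K :: nat and a b :: "nat \<Rightarrow> nat" and d :: "'e::euclidean_space" +
  fixes G :: "'g topology" and v :: "nat \<Rightarrow> 'g" and c :: "nat \<Rightarrow> real \<Rightarrow> 'g"
  assumes dim: "2 \<le> DIM('e)"
    and haus: "Hausdorff_space G"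
    and inj_v: "inj_on v {..<n}"
    and c_cont: "k < K \<Longrightarrow> continuous_map (top_of_set {0..1}) G (c k)"
    and c_ends: "k < K \<Longrightarrow> c k 0 = v (a k)" "k < K \<Longrightarrow> c k 1 = v (b k)"
    and c_inj: "k < K \<Longrightarrow> inj_on (c k) {0<..<1}"
    and c_disjoint: "\<lbrakk>k < K; l < K; k \<noteq> l\<rbrakk> \<Longrightarrow> c k ` {0<..<1} \<inter> c l ` {0<..<1} = {}"
    and c_not_vertex: "k < K \<Longrightarrow> c k ` {0<..<1} \<inter> v ` {..<n} = {}"
    and topspace_G: "topspace G = v ` {..<n} \<union> (\<Union>k<K. c k ` {0<..<1})"
begin

abbreviation V :: "'g set" where "V \<equiv> v ` {..<n}"

definition base :: "nat \<Rightarrow> nat" where "base i = (if i < n then i else i - n)"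

text \<open>In this logarithmic coordinate across a tube the inversion becomes negation.\<close>

definition lw :: "nat \<Rightarrow> 'e \<Rightarrow> real" where "lw k x = ln ((x - cen k) \<bullet> (x - cen k))"

text \<open>The parameter along edge \<open>k\<close>. Away from the wall, in the body of the sheet,
  it is 0 on \<open>a k\<close> and 1 on \<open>b k\<close>, the two ends of
  \<open>c k\<close>.\<close>

definition coord :: "nat \<Rightarrow> nat \<Rightarrow> 'e \<Rightarrow> real" where
  "coord k i x = (if i = a k then step (lw k x) else 1 - step (lw k x))"

text \<open>Here \<open>partner k i \<noteq> i\<close> expresses that sheet \<open>i\<close> carries
  a tube at wall \<open>k\<close>. The doubling wall is left out, so the second half of a doubled
  ball goes entirely to its vertex.\<close>

definition loc :: "nat \<Rightarrow> 'e \<Rightarrow> 'g" where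
  "loc i x = (if \<exists>k<K. partner k i \<noteq> i \<and> x \<in> ann k then c (wall x) (coord (wall x) i x)
     else v (base i))"

text \<open>Evaluated on the representative that the point itself carries; \<open>loc_tr\<close>
  shows that any other representative gives the same value.\<close>

definition proj :: "nat \<times> 'e \<Rightarrow> 'g" where "proj p = loc (fst p) (snd p)"

definition height :: "'g \<Rightarrow> real" where
  "height g = (if g \<in> V then real (inv_into {..<n} v g)
     else let k = SOME k. k < K \<and> g \<in> c k ` {0<..<1}
       in real (a k) + (real (b k) - real (a k)) * inv_into {0<..<1} (c k) g)"

text \<open>The bound lies strictly between \<open>sqrt (exp 1)\<close>, where the step ends, and the outer radius
  \<open>2\<close> of the annulus.\<close>

abbreviation far :: "nat \<Rightarrow> 'e set" where
  "far i \<equiv> {x. norm x < 2 * R \<and> (\<forall>k<K. partner k i \<noteq> i \<longrightarrow> 9 / 5 < norm (x - cen k))}"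

lemma c_notin_V: "k < K \<Longrightarrow> s \<in> {0<..<1} \<Longrightarrow> c k s \<notin> V"
  using c_not_vertex by blast

lemma lw_norm: "lw k x = 2 * ln (norm (x - cen k))"
  by (simp add: lw_def dot_square_norm ln_realpow)

lemma incident: "k < K \<Longrightarrow> partner k i \<noteq> i \<longleftrightarrow> i = a k \<or> i = b k"
  using ends[of k] by (auto simp: partner_def)

lemma base_in: "i \<in> Ix \<Longrightarrow> base i < n"
  by (auto simp: base_def)

lemma one_less_lw: "9 / 5 < norm (x - cen k) \<Longrightarrow> 1 < lw k x"
proof -
  assume *: "9 / 5 < norm (x - cen k)"
  have "exp 1 \<le> (3::real)" by (rule exp_le)
  also have "(3::real) < (9 / 5)\<^sup>2" by (simp add: power2_eq_square)
  also have "\<dots> < (norm (x - cen k))\<^sup>2" using * by (intro power_strict_mono) auto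
  finally have "ln (exp 1) < ln ((norm (x - cen k))\<^sup>2)"
    by (intro ln_less_cancel_iff[THEN iffD2]) auto
  then show ?thesis by (simp add: lw_norm ln_realpow)
qed

lemma norm_less_of_lw: "lw k x < 1 \<Longrightarrow> norm (x - cen k) < 2"
  using one_less_lw[of x k] by force

lemma ann_or_far:
  assumes "x \<in> dm i" "k < K" "partner k i \<noteq> i" "norm (x - cen k) \<le> 9 / 5"
  shows "x \<in> ann k"
  using assms by (auto simp: dm_def ann_inner)

lemma far_other:
  assumes "k < K" "x \<in> ann k" "l < K" "l \<noteq> k" shows "1 < lw l x"
  using near_far(2)[of k x l] assms by (intro one_less_lw) (auto simp: ann_inner)

lemma far_ann_outer: "x \<in> ann K \<Longrightarrow> l < K \<Longrightarrow> 1 < lw l x"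
  using far_outer[of x l] by (intro one_less_lw) (auto simp: ann_outer)

lemma lw_inversion: "x \<in> ann k \<Longrightarrow> k < K \<Longrightarrow> lw k (inversion k x) = - lw k x"
  using ann_not_cen[of x k] by (simp add: lw_norm norm_inversion rad_def ln_div)

lemma loc_ann:
  assumes "k < K" "partner k i \<noteq> i" "x \<in> ann k"
  shows "loc i x = c k (coord k i x)"
  using assms wall_eq[of k x] by (auto simp: loc_def)

text \<open>Inside an annulus but past the step, the edge parameter has already reached the end
  belonging to the sheet. Hence both branches of \<open>loc\<close> agree where they meet.\<close>

lemma loc_far:
  assumes i: "i \<in> Ix" and far: "\<And>k. k < K \<Longrightarrow> partner k i \<noteq> i \<Longrightarrow> 1 \<le> lw k x"
  shows "loc i x = v (base i)"
proof (cases "\<exists>k<K. partner k i \<noteq> i \<and> x \<in> ann k")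
  case True
  then obtain k where k: "k < K" "partner k i \<noteq> i" "x \<in> ann k" by blast
  have "step (lw k x) = 0" using far k by (intro step_ge) auto
  then show ?thesis
    using loc_ann[OF k] k incident[of k i] ends[of k] c_ends[of k] by (auto simp: coord_def base_def)
next
  case False
  then show ?thesis by (auto simp: loc_def)
qed

text \<open>Across the doubling wall both halves are constant with the same vertex. Across an edge
  wall \<open>lw\<close> changes sign, and \<open>step_minus\<close> exchanges the two forms of
  \<open>coord\<close>.\<close>

lemma loc_tr:
  assumes ij: "i \<in> Ix" "j \<in> Ix" and x: "x \<in> ov i j"
  shows "loc j (tr i j x) = loc i x"
proof (cases "i = j")
  case True
  then show ?thesis by (simp add: tr_def)
next
  case False
  obtain w where w: "w \<le> K" "partner w i = j" "x \<in> ann w" "tr i j x = inversion w x"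
    using x False by (rule ovE)
  note y = inversion_ann(1)[OF w(3)]
  show ?thesis
  proof (cases "w = K")
    case True
    then have "loc i x = v (base i)" "loc j (inversion w x) = v (base j)"
      using w y far_ann_outer loc_far[OF ij(1), of x] loc_far[OF ij(2), of "inversion w x"] less_imp_le
      by blast+
    moreover have "base j = base i" using ij w True by (auto simp: base_def partner_def)
    ultimately show ?thesis using w by simp
  next
    case less: False
    then have k: "w < K" using w by simp
    have pi: "partner w i \<noteq> i" and pj: "partner w j \<noteq> j"
      using w(2) False partner_partner[OF ij(1), of w] by auto
    have "coord w j (inversion w x) = coord w i x"
      using incident[OF k, of i] incident[OF k, of j] pi pj False ends[OF k] lw_inversion[OF w(3) k] step_minus
      by (auto simp: coord_def)
    then show ?thesis
      using loc_ann[OF k pi w(3)] loc_ann[OF k pj y] w by simp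
  qed
qed

lemma proj_psi: "i \<in> Ix \<Longrightarrow> x \<in> dm i \<Longrightarrow> proj (psi i x) = loc i x"
  by (metis psi_rep loc_tr proj_def fst_conv snd_conv)

lemma continuous_on_lw: "continuous_on (ann k) (lw k)"
  unfolding lw_def by (intro continuous_intros) (auto dest: ann_not_cen)

lemma open_far: "open (far i)"
proof -
  have "far i =
     {x. norm x < 2 * R} \<inter> (\<Inter>k\<in>{k. k < K \<and> partner k i \<noteq> i}. {x. 9 / 5 < norm (x - cen k)})"
    by auto
  then show ?thesis
    by (auto intro!: open_Int open_INT open_Collect_less continuous_intros)
qed

text \<open>Pasting over an open cover: \<open>far i\<close>, where the map is constant, and the
  annuli of the incident edges, where it is a path composed with \<open>coord\<close>.\<close>

lemma continuous_map_loc: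
  assumes i: "i \<in> Ix" shows "continuous_map (top_of_set (dm i)) G (loc i)"
proof -
  have F: "loc i x = v (base i)" if "x \<in> far i" for x
    using that loc_far[OF i, of x] one_less_lw[of x] less_imp_le by blast
  have tube: "continuous_map (top_of_set (ann k)) G (loc i)" if k: "k < K" "partner k i \<noteq> i" for k
  proof (rule continuous_map_eq)
    have "continuous_on (ann k) (coord k i)"
      unfolding coord_def
      by (cases "i = a k") (auto intro!: continuous_intros continuous_on_lw
          continuous_on_compose2[OF continuous_on_step continuous_on_lw])
    then have "continuous_map (top_of_set (ann k)) (top_of_set {0..1}) (coord k i)"
      using step_range by (auto simp: coord_def)
    then show "continuous_map (top_of_set (ann k)) G (c k \<circ> coord k i)"
      using c_cont[OF k(1)] by (rule continuous_map_compose)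
  qed (use loc_ann k in auto)
  have cover: "x \<in> far i \<or> (\<exists>k<K. partner k i \<noteq> i \<and> x \<in> ann k)" if "x \<in> dm i" for x
  proof -
    have "norm x < 2 * R" using that by (simp add: dm_def)
    then show ?thesis using ann_or_far[OF that] by force
  qed
  show ?thesis
    unfolding continuous_map_def
  proof (intro conjI allI impI)
    show "loc i \<in> topspace (top_of_set (dm i)) \<rightarrow> topspace G"
    proof
      fix x assume "x \<in> topspace (top_of_set (dm i))"
      then consider "x \<in> far i" | k where "k < K" "partner k i \<noteq> i" "x \<in> ann k"
        using cover by auto
      then show "loc i x \<in> topspace G"
      proof cases
        case 1
        then show ?thesis using F base_in[OF i] by (auto simp: topspace_G)
      next
        case 2
        then show ?thesis using tube[of k] by (auto simp: continuous_map_def Pi_iff)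
      qed
    qed
    fix U assume U: "openin G U"
    have "{x \<in> dm i. loc i x \<in> U} = (\<Union>k\<in>{k. k < K \<and> partner k i \<noteq> i}. {x \<in> ann k. loc i x \<in> U})
        \<union> (if v (base i) \<in> U then far i else {})" (is "?A = ?B")
    proof (intro subset_antisym subsetI)
      fix x assume "x \<in> ?A" then show "x \<in> ?B" using cover[of x] F[of x] by auto
    next
      fix x assume "x \<in> ?B"
      then consider "x \<in> far i" "v (base i) \<in> U" | k where "k < K" "partner k i \<noteq> i" "x \<in> ann k" "loc i x \<in> U"
        by (auto split: if_splits)
      then show "x \<in> ?A"
      proof cases
        case 1
        then show ?thesis using F[OF 1(1)] by (force simp: dm_def)
      next
        case 2
        then show ?thesis using ann_subset_dm[of k i] by auto
      qed
    qed
    moreover have "open {x \<in> ann k. loc i x \<in> U}" if "k < K" "partner k i \<noteq> i" for k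
      using tube[OF that] U by (simp add: continuous_map_def openin_open_eq open_ann)
    then have "open ?B" using open_far[of i] by auto
    ultimately have "open ?A" by (simp only:)
    then show "openin (top_of_set (dm i)) {x \<in> topspace (top_of_set (dm i)). loc i x \<in> U}"
      by (auto simp: openin_open_eq open_dm)
  qed
qed

lemma continuous_map_proj: "continuous_map glued G proj"
proof (rule continuous_map_from_glued)
  fix i assume i: "i \<in> Ix"
  show "continuous_map (top_of_set (dm i)) G (\<lambda>x. proj (psi i x))"
    by (rule continuous_map_eq[OF continuous_map_loc[OF i]]) (simp add: proj_psi[OF i])
qed

lemma height_v: "i < n \<Longrightarrow> height (v i) = real i"
  by (simp add: height_def inj_v)

lemma height_c:
  assumes k: "k < K" and s: "s \<in> {0..1}"
  shows "height (c k s) = real (a k) + (real (b k) - real (a k)) * s"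
proof -
  consider "s = 0" | "s = 1" | "s \<in> {0<..<1}" using s by fastforce
  then show ?thesis
  proof cases
    case 3
    then have "c k s \<notin> V" by (rule c_notin_V[OF k])
    moreover have "(SOME l. l < K \<and> c k s \<in> c l ` {0<..<1}) = k"
      using k 3 c_disjoint[of _ k] by (intro some_equality) blast+
    ultimately show ?thesis
      using inv_into_f_f[OF c_inj[OF k] 3] by (simp add: height_def)
  qed (use k ends[OF k] in \<open>auto simp: c_ends height_v\<close>)
qed

text \<open>The height is affine on an edge, with nonzero slope since the ends differ. So an edge
  contributes at most one point, the solution of a linear equation.\<close>

lemma finite_height: "finite {g \<in> topspace G. height g = y}"
proof -
  have "{g \<in> topspace G. height g = y} \<subseteq>
      V \<union> (\<Union>k<K. {c k ((y - real (a k)) / (real (b k) - real (a k)))})"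
  proof
    fix g assume g: "g \<in> {g \<in> topspace G. height g = y}"
    show "g \<in> V \<union> (\<Union>k<K. {c k ((y - real (a k)) / (real (b k) - real (a k)))})"
    proof (cases "g \<in> V")
      case False
      then obtain k s where k: "k < K" "s \<in> {0<..<1}" "g = c k s" using g topspace_G by auto
      then have "y = real (a k) + (real (b k) - real (a k)) * s"
        using g height_c[of k s] by auto
      moreover have "real (b k) - real (a k) \<noteq> 0" using ends(3)[OF k(1)] by simp
      ultimately have "(y - real (a k)) / (real (b k) - real (a k)) = s" by simp
      then show ?thesis using k by auto
    qed simp
  qed
  then show ?thesis by (rule finite_subset) simp
qed

text \<open>Written from the viewpoint of sheet \<open>i\<close>, so that both ends of the edge obey
  one formula and the orientation of \<open>c k\<close> no longer matters.\<close>

lemma height_ann: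
  assumes "k < K" "partner k i \<noteq> i" "x \<in> ann k"
  shows "height (loc i x) = real i + (real (partner k i) - real i) * step (lw k x)"
proof -
  have "coord k i x \<in> {0..1}" using step_range by (auto simp: coord_def)
  then show ?thesis
    using loc_ann[OF assms] height_c[OF assms(1), of "coord k i x"] incident[OF assms(1), of i] assms ends[OF assms(1)]
    by (auto simp: coord_def partner_def algebra_simps)
qed

lemma height_far:
  assumes "i \<in> Ix" "x \<in> dm i" "\<And>k. k < K \<Longrightarrow> partner k i \<noteq> i \<Longrightarrow> 9 / 5 < norm (x - cen k)"
  shows "height (loc i x) = real (base i)"
  using loc_far[of i x] one_less_lw assms base_in[of i] by (fastforce simp: height_v)

section \<open>Smoothness and critical points of the height\<close>

lemma smooth_height_loc:
  assumes i: "i \<in> Ix" shows "Ck_on m (dm i) (\<lambda>x. height (loc i x))"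
proof (rule Ck_on_local)
  fix x assume x: "x \<in> dm i"
  show "\<exists>T. open T \<and> x \<in> T \<and> Ck_on m T (\<lambda>x. height (loc i x))"
  proof (cases "\<exists>k<K. partner k i \<noteq> i \<and> x \<in> ann k")
    case True
    then obtain k where k: "k < K" "partner k i \<noteq> i" "x \<in> ann k" by blast
    have "Ck_on m (ann k) (lw k)"
      unfolding lw_def[abs_def]
      by (rule Ck_on_compose_real[OF open_ann _ _ Ck_on_norm_square[OF open_ann] Ck_on_ln])
        (auto dest: ann_not_cen)
    then have "Ck_on m (ann k) (\<lambda>x. step (lw k x))"
      by (rule Ck_on_compose_real[OF open_ann open_UNIV subset_UNIV _ Ck_on_step])
    then have "Ck_on m (ann k) (\<lambda>x. real i + (real (partner k i) - real i) * step (lw k x))"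
      by (intro Ck_on_add Ck_on_mult Ck_on_const open_ann)
    then have "Ck_on m (ann k) (\<lambda>x. height (loc i x))"
      by (rule Ck_on_cong[OF open_ann, rotated]) (simp add: height_ann[OF k(1,2)])
    then show ?thesis using k open_ann by blast
  next
    case False
    have "Ck_on m (far i) (\<lambda>x. height (loc i x))"
    proof (rule Ck_on_cong[OF open_far _ Ck_on_const])
      fix y assume y: "y \<in> far i"
      then have "y \<in> dm i" by (force simp: dm_def)
      then show "real (base i) = height (loc i y)" using y by (intro height_far[symmetric] i) auto
    qed
    moreover have "x \<in> far i"
      using x False ann_or_far[OF x] by (force simp: dm_def)
    ultimately show ?thesis using open_far by blast
  qed
qed

lemma smooth_height: "smooth_function charts (\<lambda>p. height (proj p))"
proof (rule smooth_function)
  fix i m assume i: "i \<in> Ix"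
  show "Ck_on m (dm i) (\<lambda>x. height (proj (psi i x)))"
    by (rule Ck_on_cong[OF open_dm _ smooth_height_loc[OF i]]) (simp add: proj_psi[OF i])
qed

lemma coord_interior: "coord k i x \<in> {0<..<1} \<longleftrightarrow> \<bar>lw k x\<bar> < 1"
  using step_in_iff[of "lw k x"] by (auto simp: coord_def)

lemma loc_ann_vertex_iff:
  assumes "k < K" "partner k i \<noteq> i" "x \<in> ann k"
  shows "loc i x \<in> V \<longleftrightarrow> 1 \<le> \<bar>lw k x\<bar>"
proof (cases "1 \<le> \<bar>lw k x\<bar>")
  case True
  then have "coord k i x \<in> {0, 1}"
    using step_ge[of "lw k x"] step_le[of "lw k x"] by (auto simp: coord_def abs_if split: if_splits)
  then show ?thesis
    using loc_ann[OF assms] c_ends[OF assms(1)] ends[OF assms(1)] True by auto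
next
  case False
  then show ?thesis
    using loc_ann[OF assms] coord_interior[of k i x] c_notin_V[OF assms(1)] by auto
qed

text \<open>On an annulus the derivative is \<open>step'\<close> times a nonvanishing radial form,
  so it is zero exactly where the step is over, which is where \<open>loc\<close> has reached a
  vertex. Elsewhere the height is locally constant.\<close>

lemma has_derivative_height:
  assumes i: "i \<in> Ix" and x: "x \<in> dm i"
  shows "((\<lambda>x. height (loc i x)) has_derivative (\<lambda>_. 0)) (at x) \<longleftrightarrow> loc i x \<in> V"
proof (cases "\<exists>k<K. partner k i \<noteq> i \<and> x \<in> ann k")
  case True
  then obtain k where k: "k < K" "partner k i \<noteq> i" "x \<in> ann k" by blast
  define y where "y = x - cen k"
  have y: "y \<bullet> y > 0" using ann_not_cen[OF k(3)] by (simp add: y_def)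
  define D where "D h = (real (partner k i) - real i) * (step' (lw k x) * (2 * (y \<bullet> h) / (y \<bullet> y)))" for h
  have "((\<lambda>x. (x - cen k) \<bullet> (x - cen k)) has_derivative (\<lambda>h. 2 * (y \<bullet> h))) (at x)"
    by (auto intro!: derivative_eq_intros simp: y_def inner_commute)
  moreover have "(ln has_real_derivative inverse (y \<bullet> y)) (at ((x - cen k) \<bullet> (x - cen k)))"
    using y by (auto simp: y_def intro!: DERIV_ln)
  ultimately have "(lw k has_derivative (\<lambda>h. 2 * (y \<bullet> h) / (y \<bullet> y))) (at x)"
    unfolding lw_def[abs_def] has_field_derivative_def
    by (auto dest: has_derivative_compose simp: divide_inverse mult.commute)
  from has_derivative_compose[OF this DERIV_step[unfolded has_field_derivative_def]]
  have "((\<lambda>x. real i + (real (partner k i) - real i) * step (lw k x)) has_derivative D) (at x)"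
    unfolding D_def by (auto intro!: derivative_eq_intros)
  then have D: "((\<lambda>x. height (loc i x)) has_derivative D) (at x)"
    by (rule has_derivative_transform_within_open[OF _ open_ann k(3)]) (simp add: height_ann[OF k(1,2)])
  have "D = (\<lambda>_. 0) \<longleftrightarrow> step' (lw k x) = 0"
  proof
    assume "D = (\<lambda>_. 0)"
    \<comment> \<open>The radial direction detects the derivative: the inner products cancel,
      leaving \<open>step'\<close> times twice a nonzero difference of vertex heights.\<close>
    then have "D y = 0" by simp
    then show "step' (lw k x) = 0" using y k by (simp add: D_def)
  qed (simp add: D_def[abs_def])
  moreover have "((\<lambda>x. height (loc i x)) has_derivative (\<lambda>_. 0)) (at x) \<longleftrightarrow> D = (\<lambda>_. 0)"
    using D has_derivative_unique by metis
  moreover have "step' (lw k x) = 0 \<longleftrightarrow> 1 \<le> \<bar>lw k x\<bar>"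
    using step'_zero step'_neg by (metis less_irrefl not_le)
  ultimately show ?thesis using loc_ann_vertex_iff[OF k] by simp
next
  case False
  have xF: "x \<in> far i" using x False ann_or_far[OF x] by (force simp: dm_def)
  have "real (base i) = height (loc i y)" if "y \<in> far i" for y
  proof -
    have "y \<in> dm i" using that by (force simp: dm_def)
    then show ?thesis using that by (intro height_far[symmetric] i) auto
  qed
  then have "((\<lambda>x. height (loc i x)) has_derivative (\<lambda>_. 0)) (at x)"
    by (rule has_derivative_transform_within_open[OF has_derivative_const open_far xF])
  moreover have "loc i x = v (base i)"
    using xF loc_far[OF i, of x] one_less_lw[of x] less_imp_le by blast
  ultimately show ?thesis using base_in[OF i] by simp
qed

lemma critical_points_height:
  "critical_points charts (\<lambda>p. height (proj p)) = {p \<in> topspace glued. proj p \<in> V}"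
proof -
  have "((\<lambda>x. height (proj (psi i x))) has_derivative (\<lambda>_. 0)) (at x) \<longleftrightarrow> proj (psi i x) \<in> V"
    if i: "i \<in> Ix" and x: "x \<in> dm i" for i x
  proof -
    have "((\<lambda>x. height (proj (psi i x))) has_derivative (\<lambda>_. 0)) (at x) \<longleftrightarrow>
        ((\<lambda>x. height (loc i x)) has_derivative (\<lambda>_. 0)) (at x)"
      by (intro iffI; erule has_derivative_transform_within_open[OF _ open_dm x])
        (simp_all add: proj_psi[OF i])
    then show ?thesis using has_derivative_height[OF i x] proj_psi[OF i x] by simp
  qed
  then have "{psi i x | i x. i \<in> Ix \<and> x \<in> dm i \<and>
        ((\<lambda>x. height (proj (psi i x))) has_derivative (\<lambda>_. 0)) (at x)} =
      {psi i x | i x. i \<in> Ix \<and> x \<in> dm i \<and> proj (psi i x) \<in> V}"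
    by (metis (no_types, lifting))
  also have "\<dots> = {p \<in> topspace glued. proj p \<in> V}"
    unfolding topspace_glued points_def by blast
  finally show ?thesis unfolding critical_points .
qed

lemma finite_critical_values: "finite (critical_values charts (\<lambda>p. height (proj p)))"
  unfolding critical_values_def critical_points_height
  by (rule finite_subset[of _ "height ` V"]) auto

section \<open>Fibres of the map to the graph\<close>

lemma exp_half: "1 < exp (1 / 2 :: real)" "exp (1 / 2 :: real) < 9 / 5"
proof -
  show "exp (1 / 2 :: real) < 9 / 5"
  proof (rule power2_less_imp_less)
    have "(exp (1 / 2))\<^sup>2 = (exp 1 :: real)" by (simp add: power2_eq_square flip: exp_add)
    also have "\<dots> \<le> 3" by (rule exp_le)
    also have "\<dots> < (9 / 5 :: real)\<^sup>2" by (simp add: power2_eq_square)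
    finally show "(exp (1 / 2))\<^sup>2 < (9 / 5 :: real)\<^sup>2" .
  qed simp
qed simp

text \<open>By \<open>lw_norm\<close> the level \<open>u\<close> of \<open>lw\<close> is the sphere
  of radius \<open>exp (u / 2)\<close>. Points seen from sheet \<open>b k\<close> are carried to
  sheet \<open>a k\<close> by the inversion, so one sphere in one sheet is the whole fibre.\<close>

lemma edge_fibre:
  assumes k: "k < K" and u: "\<bar>u\<bar> < 1"
  shows "{p \<in> topspace glued. proj p = c k (step u)} = psi (a k) ` {x. norm (x - cen k) = exp (u / 2)}"
    and "{x. norm (x - cen k) = exp (u / 2)} \<subseteq> ann k"
proof -
  let ?S = "{x. norm (x - cen k) = exp (u / 2)}"
  have ak: "a k \<in> Ix" "b k \<in> Ix" "partner k (a k) = b k" "partner k (b k) = a k" "a k \<noteq> b k"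
    using ends[OF k] k by (auto simp: partner_def)
  have "1 / 2 < exp (- (1 / 2) :: real)" using exp_half by (simp add: exp_minus field_simps)
  moreover have "exp (- (1 / 2)) < exp (u / 2)" "exp (u / 2) < exp (1 / 2)" using u by auto
  ultimately have "1 / 2 < exp (u / 2)" "exp (u / 2) < 2" using exp_half by linarith+
  then show S: "?S \<subseteq> ann k" using k by (auto simp: ann_inner)
  have lwS: "lw k x = u \<longleftrightarrow> x \<in> ?S" if "x \<in> ann k" for x
  proof -
    have "norm (x - cen k) > 0" using ann_not_cen[OF that] by simp
    then have "ln (norm (x - cen k)) = u / 2 \<longleftrightarrow> norm (x - cen k) = exp (u / 2)"
      by (metis exp_ln ln_exp)
    then show ?thesis by (auto simp: lw_norm)
  qed
  show "{p \<in> topspace glued. proj p = c k (step u)} = psi (a k) ` ?S"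
  proof (intro subset_antisym subsetI)
    fix p assume "p \<in> {p \<in> topspace glued. proj p = c k (step u)}"
    then obtain i x where i: "i \<in> Ix" "x \<in> dm i" "p = psi i x" and loc: "loc i x = c k (step u)"
      by (auto elim!: glued_cases simp: proj_psi)
    have su: "step u \<in> {0<..<1}" using step_in_iff u by blast
    have nV: "loc i x \<notin> V" using c_notin_V[OF k su] loc by simp
    have "\<exists>l<K. partner l i \<noteq> i \<and> x \<in> ann l"
    proof (rule ccontr)
      assume "\<not> ?thesis"
      then have "loc i x = v (base i)" by (auto simp: loc_def)
      then show False using nV base_in[OF i(1)] by simp
    qed
    then obtain l where l: "l < K" "partner l i \<noteq> i" "x \<in> ann l" by blast
    have co: "coord l i x \<in> {0<..<1}"
      using nV loc_ann_vertex_iff[OF l] coord_interior[of l i x] by auto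
    then have "l = k"
      using c_disjoint[OF l(1) k] loc loc_ann[OF l] su by (metis IntI empty_iff image_eqI)
    then have l: "partner k i \<noteq> i" "x \<in> ann k" and co: "coord k i x \<in> {0<..<1}"
      using l co by auto
    have eq: "coord k i x = step u"
      using inj_onD[OF c_inj[OF k]] co su loc loc_ann[OF k l] by metis
    consider "i = a k" | "i = b k" using incident[OF k] l by blast
    then show "p \<in> psi (a k) ` ?S"
    proof cases
      case 1
      then have "lw k x = u" using eq step_inj[OF u] by (simp add: coord_def)
      then show ?thesis using lwS l i 1 by blast
    next
      case 2
      then have "step (- lw k x) = step u" using eq ak step_minus by (simp add: coord_def)
      then have "lw k (inversion k x) = u" using step_inj[OF u] lw_inversion[OF l(2) k] by simp
      then have "inversion k x \<in> ?S" using lwS inversion_ann(1)[OF l(2)] by blast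
      moreover have "psi (a k) (inversion k x) = p"
        using psi_tr[OF i(1) ak(1), of x] ovI[of k i "a k" x] trI[of k i "a k" x] 2 ak k l i by simp
      ultimately show ?thesis by blast
    qed
  next
    fix p assume "p \<in> psi (a k) ` ?S"
    then obtain x where x: "x \<in> ?S" "p = psi (a k) x" by blast
    then have xa: "x \<in> ann k" using S by blast
    then have "x \<in> dm (a k)" using ann_subset_dm k by (meson less_imp_le subsetD)
    moreover have "loc (a k) x = c k (step u)"
      using loc_ann[OF k _ xa] lwS[OF xa] x ak by (simp add: coord_def)
    ultimately show "p \<in> {p \<in> topspace glued. proj p = c k (step u)}"
      using x ak psi_in_glued proj_psi by auto
  qed
qed

text \<open>The part of a sheet where every step is over; \<open>exp (1 / 2)\<close> is the distance
  at which \<open>lw\<close> equals 1.\<close>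

definition flat :: "nat \<Rightarrow> 'e set" where
  "flat i = {x. norm x < 2 * R \<and> (\<forall>k<K. partner k i \<noteq> i \<longrightarrow> exp (1 / 2) \<le> norm (x - cen k))}"

lemma flat_iff: "x \<in> flat i \<longleftrightarrow> x \<in> dm i \<and> (\<forall>k<K. partner k i \<noteq> i \<longrightarrow> 1 \<le> lw k x)"
proof -
  have "exp (1 / 2) \<le> norm (x - cen k) \<longleftrightarrow> 1 / 2 < norm (x - cen k) \<and> 1 \<le> lw k x" for k
  proof (cases "x = cen k")
    case True
    then show ?thesis using exp_half(1) by simp
  next
    case False
    then have "1 \<le> lw k x \<longleftrightarrow> exp (1 / 2) \<le> norm (x - cen k)"
      using ln_ge_iff[of "norm (x - cen k)" "1 / 2"] by (auto simp: lw_norm)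
    then show ?thesis using exp_half(1) by linarith
  qed
  then show ?thesis by (auto simp: flat_def dm_def)
qed

lemma connected_flat: "connected (flat i)"
proof -
  \<comment> \<open>\<open>r\<close> retracts the ball punctured at the centres onto \<open>flat i\<close> by pushing radially outwards.\<close>
  define J where "J = {k. k < K \<and> partner k i \<noteq> i}"
  define \<rho> where "\<rho> = exp (1 / 2 :: real)"
  have rho: "1 < \<rho>" "\<rho> < 2" using exp_half by (auto simp: \<rho>_def)
  define r where "r x = x + (\<Sum>k\<in>J. max (\<rho> / norm (x - cen k) - 1) 0 *\<^sub>R (x - cen k))" for x
  let ?B = "ball 0 (2 * R) - cen ` J"
  have flat: "flat i = {x. norm x < 2 * R \<and> (\<forall>k\<in>J. \<rho> \<le> norm (x - cen k))}"
    by (auto simp: flat_def J_def \<rho>_def)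
  have fin: "finite J" by (simp add: J_def)
  have out: "max (\<rho> / norm (x - cen k) - 1) 0 = 0" if "\<rho> \<le> norm (x - cen k)" for x k
    using that rho by (simp add: max_def divide_le_eq_1)
  have id: "r x = x" if "x \<in> flat i" for x
    using that out by (simp add: r_def flat)
  have "r x \<in> flat i" if x: "x \<in> ?B" for x
  proof (cases "x \<in> flat i")
    case True
    then show ?thesis using id by simp
  next
    case False
    then obtain k where k: "k \<in> J" "norm (x - cen k) < \<rho>" using x by (force simp: flat)
    have kK: "k < K" using k by (simp add: J_def)
    have near: "norm (x - cen k) \<le> 2" using k rho by linarith
    \<comment> \<open>The balls of radius \<open>\<rho>\<close> about the centres are disjoint, so
      at most one summand of the displacement is nonzero.\<close>
    have other: "max (\<rho> / norm (x - cen l) - 1) 0 *\<^sub>R (x - cen l) = 0" if "l \<in> J - {k}" for l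
      using near_far(2)[OF kK near, of l] that rho out[of x l] by (auto simp: J_def)
    have pos: "norm (x - cen k) > 0" using x k by auto
    have "(\<Sum>l\<in>J. max (\<rho> / norm (x - cen l) - 1) 0 *\<^sub>R (x - cen l)) =
        max (\<rho> / norm (x - cen k) - 1) 0 *\<^sub>R (x - cen k)"
      using sum.remove[OF fin k(1), of "\<lambda>l. max (\<rho> / norm (x - cen l) - 1) 0 *\<^sub>R (x - cen l)"] other by simp
    also have "max (\<rho> / norm (x - cen k) - 1) 0 = \<rho> / norm (x - cen k) - 1"
      using k pos by (simp add: max_def divide_simps)
    finally have "r x - cen k = (\<rho> / norm (x - cen k)) *\<^sub>R (x - cen k)"
      by (simp add: r_def algebra_simps)
    then have n: "norm (r x - cen k) = \<rho>" using pos rho by simp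
    then have n2: "norm (r x - cen k) \<le> 2" using rho by simp
    have "\<rho> \<le> norm (r x - cen l)" if "l \<in> J" for l
      using near_far(2)[OF kK n2, of l] that n rho by (cases "l = k") (auto simp: J_def)
    moreover have "norm (r x) < 2 * R" using near_far(1)[OF kK n2] R_ge by simp
    ultimately show ?thesis by (simp add: flat)
  qed
  moreover have "flat i \<subseteq> ?B" using rho by (force simp: flat)
  ultimately have im: "r ` ?B = flat i" using id by force
  have "continuous_on ?B r"
    unfolding r_def by (intro continuous_intros) auto
  \<comment> \<open>Uses dimension at least 2: a ball stays connected when finitely many points are
    removed.\<close>
  moreover have "connected ?B"
    using dim fin by (intro connected_open_diff_countable) (auto intro: countable_finite)
  ultimately show ?thesis using connected_continuous_image im by metis
qed

lemma cap: "i < n \<Longrightarrow> k < K \<Longrightarrow> partner k (n + i) = n + i"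
  using ends[of k] by (auto simp: partner_def)

text \<open>Past the middle of a tube, a point of a neighbouring sheet may still lie over
  \<open>v i\<close>; the inversion then places it in the flat part of sheet \<open>i\<close>, so no
  further pieces arise.\<close>

lemma vertex_fibre:
  assumes i: "i < n"
  shows "{p \<in> topspace glued. proj p = v i} = psi i ` flat i \<union> psi (n + i) ` dm (n + i)"
proof (intro subset_antisym subsetI)
  fix p assume "p \<in> {p \<in> topspace glued. proj p = v i}"
  then obtain j x where j: "j \<in> Ix" "x \<in> dm j" "p = psi j x" and loc: "loc j x = v i"
    by (auto elim!: glued_cases simp: proj_psi)
  have flat_case: "psi j x \<in> psi i ` flat i \<union> psi (n + i) ` dm (n + i)"
    if j: "j \<in> Ix" "x \<in> flat j" and loc: "loc j x = v i" for j x
  proof -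
    have x: "x \<in> dm j" "\<And>k. k < K \<Longrightarrow> partner k j \<noteq> j \<Longrightarrow> 1 \<le> lw k x"
      using j flat_iff by auto
    then have "v (base j) = v i" using loc_far[OF j(1), of x] loc by simp
    then have "base j = i" using inj_onD[OF inj_v] base_in[OF j(1)] i by auto
    then have "j = i \<or> j = n + i" by (auto simp: base_def split: if_splits)
    then show ?thesis using x j by blast
  qed
  show "p \<in> psi i ` flat i \<union> psi (n + i) ` dm (n + i)"
  proof (cases "x \<in> flat j")
    case True
    then show ?thesis using flat_case j loc by simp
  next
    case False
    then obtain k where k: "k < K" "partner k j \<noteq> j" "lw k x < 1"
      using j flat_iff by force
    have xa: "x \<in> ann k" using j k norm_less_of_lw by (auto simp: dm_def ann_inner)
    have "loc j x \<in> V" using loc i by auto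
    \<comment> \<open>Over a vertex \<open>\<bar>lw k x\<bar>\<close> is at least 1, and
      \<open>lw k x < 1\<close> excludes the near side. So \<open>x\<close> is beyond the tube, and
      its inverse has \<open>lw\<close> at least 1.\<close>
    then have le: "lw k x \<le> -1" using loc_ann_vertex_iff[OF k(1,2) xa] k(3) by linarith
    let ?j = "partner k j" and ?y = "inversion k x"
    have y: "?y \<in> ann k" using inversion_ann xa by blast
    have xo: "x \<in> ov j ?j" "tr j ?j x = ?y" 
      using k xa ovI[of k j ?j x] trI[of k j ?j x] by auto
    have jn: "?j \<in> Ix" using partner_in j by blast
    have "1 \<le> lw l ?y" if "l < K" for l
      using far_other[OF k(1) y that] lw_inversion[OF xa k(1)] le by (cases "l = k") auto
    then have "?y \<in> flat ?j" using ann_subset_dm[of k] k y by (auto simp: flat_iff)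
    moreover have "loc ?j ?y = v i" using loc_tr[OF j(1) jn xo(1)] xo loc by simp
    moreover have "psi ?j ?y = p" using psi_tr[OF j(1) jn xo(1)] xo j by simp
    ultimately show ?thesis using flat_case[OF jn] by metis
  qed
next
  fix p assume "p \<in> psi i ` flat i \<union> psi (n + i) ` dm (n + i)"
  moreover have "dm (n + i) = flat (n + i)" using cap[OF i] by (auto simp: flat_iff)
  ultimately obtain j x where j: "j = i \<or> j = n + i" "x \<in> flat j" "p = psi j x"
    by blast
  then have "j \<in> Ix" "x \<in> dm j" "base j = i" using i by (auto simp: flat_iff base_def)
  moreover have "loc j x = v (base j)" using j by (intro loc_far \<open>j \<in> Ix\<close>) (auto simp: flat_iff)
  ultimately show "p \<in> {p \<in> topspace glued. proj p = v i}"
    using j psi_in_glued proj_psi by auto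
qed

lemma connectedin_psi:
  assumes "i \<in> Ix" "S \<subseteq> dm i" "connected S" shows "connectedin glued (psi i ` S)"
  using assms by (intro connectedin_continuous_map_image[OF continuous_map_psi])
    (auto simp: connectedin_subtopology)

lemma connectedin_fibre:
  assumes "g \<in> topspace G" shows "connectedin glued {p \<in> topspace glued. proj p = g}"
proof (cases "g \<in> V")
  case True
  then obtain i where i: "i < n" "g = v i" by auto
  then have ix: "i \<in> Ix" "n + i \<in> Ix" by auto
  have "dm (n + i) = ball 0 (2 * R)" using cap[OF i(1)] by (auto simp: dm_def)
  then have "connectedin glued (psi (n + i) ` dm (n + i))"
    by (intro connectedin_psi ix) auto
  moreover have "connectedin glued (psi i ` flat i)"
    by (intro connectedin_psi ix connected_flat) (auto simp: flat_iff)
  moreover have "psi i ` flat i \<inter> psi (n + i) ` dm (n + i) \<noteq> {}"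
  proof -
    \<comment> \<open>A point of the doubling wall lies in both halves of the vertex fibre, so the
      two connected pieces meet.\<close>
    define z where "z = R *\<^sub>R d"
    have z: "z \<in> ann K" using R_ge by (simp add: z_def ann_outer norm_d)
    have "partner K i = n + i" "i \<noteq> n + i" using i by (auto simp: partner_def)
    then have o: "z \<in> ov i (n + i)" using z by (intro ovI[of K]) auto
    have "z \<in> flat i"
      using z far_ann_outer ann_subset_dm[of K i] by (auto simp: flat_iff intro: less_imp_le)
    moreover have "tr i (n + i) z \<in> dm (n + i)" using tr_in[OF ix o] ov_subset[OF ix(2,1)] by blast
    ultimately show ?thesis using psi_tr[OF ix o] by blast
  qed
  ultimately show ?thesis
    using vertex_fibre[OF i(1)] i by (simp add: connectedin_Un)
next
  case False
  then obtain k s where k: "k < K" "s \<in> {0<..<1}" "g = c k s" using assms topspace_G by auto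
  then obtain u where u: "\<bar>u\<bar> < 1" "step u = s" using step_surj by blast
  \<comment> \<open>The second use of dimension at least 2: in dimension 1 this sphere would be two
    points.\<close>
  have "{x. norm (x - cen k) = exp (u / 2)} = sphere (cen k) (exp (u / 2))"
    by (auto simp: dist_norm norm_minus_commute)
  then have "connected {x. norm (x - cen k) = exp (u / 2)}"
    using connected_sphere[OF dim] by metis
  then have "connectedin glued (psi (a k) ` {x. norm (x - cen k) = exp (u / 2)})"
    using edge_fibre(2)[OF k(1) u(1)] ann_subset_dm[of k "a k"] k ends[OF k(1)]
    by (intro connectedin_psi) auto
  then show ?thesis using edge_fibre(1)[OF k(1) u(1)] u k by simp
qed

lemma proj_surj: "proj ` topspace glued = topspace G"
proof
  show "proj ` topspace glued \<subseteq> topspace G"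
    using continuous_map_proj by (auto simp: continuous_map_def Pi_iff)
  show "topspace G \<subseteq> proj ` topspace glued"
  proof
    fix g assume g: "g \<in> topspace G"
    have "{p \<in> topspace glued. proj p = g} \<noteq> {}"
    proof (cases "g \<in> V")
      case True
      then obtain i where i: "i < n" "g = v i" by auto
      have "0 \<in> dm (n + i)" using cap[OF i(1)] R_ge by (auto simp: dm_def)
      then show ?thesis using vertex_fibre[OF i(1)] i by blast
    next
      case False
      then obtain k s where k: "k < K" "s \<in> {0<..<1}" "g = c k s" using g topspace_G by auto
      then obtain u where u: "\<bar>u\<bar> < 1" "step u = s" using step_surj by blast
      have "cen k + exp (u / 2) *\<^sub>R d \<in> {x. norm (x - cen k) = exp (u / 2)}"
        by (simp add: norm_d)
      then show ?thesis using edge_fibre(1)[OF k(1) u(1)] u k by blast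
    qed
    then show "g \<in> proj ` topspace glued" by blast
  qed
qed

lemma is_reeb_space_of_height:
  assumes "graph G V E" shows "is_reeb_space_of G V E glued charts (\<lambda>p. height (proj p))"
  by (rule is_reeb_space_ofI[where P = proj and H = height])
    (rule assms compact_space continuous_map_proj proj_surj connectedin_fibre finite_height
      critical_points_height refl | assumption)+

end

theorem corollary5p5:
  fixes G :: "'g topology" and V :: "'g set" and E :: "'g set set"
  assumes "CARD('m::finite) \<ge> 2"
    and "graph G V E"
    and "\<forall>e\<in>E. \<not> is_loop G V e"
  shows "\<exists>(M :: (nat \<times> (real ^ 'm)) topology) (A :: (nat \<times> (real ^ 'm), real ^ 'm) atlas)
            (f :: nat \<times> (real ^ 'm) \<Rightarrow> real).
           closed_smooth_manifold M A \<and> smooth_function A f \<and>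
           finite (critical_values A f) \<and>
           is_reeb_space_of G V E M A f"
proof -
  have G: "Hausdorff_space G" "finite V" "V \<subseteq> topspace G" "finite E" "disjoint E"
    "\<Union>E = topspace G - V" and ch: "\<And>e. e \<in> E \<Longrightarrow> \<exists>c. characteristic_map G V e c"
    using assms(2) by (auto simp: graph_def)
  obtain v where v: "bij_betw v {0..<card V} V" using ex_bij_betw_nat_finite[OF G(2)] by blast
  obtain e where e: "bij_betw e {0..<card E} E" using ex_bij_betw_nat_finite[OF G(4)] by blast
  have vV: "v ` {..<card V} = V" and inj_v: "inj_on v {..<card V}"
    using v by (auto simp: bij_betw_def lessThan_atLeast0)
  have eE: "e ` {..<card E} = E" and inj_e: "inj_on e {..<card E}"
    using e by (auto simp: bij_betw_def lessThan_atLeast0)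
  have "\<forall>k\<in>{..<card E}. \<exists>c. characteristic_map G V (e k) c" using ch eE by blast
  then obtain c where c: "\<And>k. k < card E \<Longrightarrow> characteristic_map G V (e k) (c k)"
    using bchoice by (metis lessThan_iff)
  have ek: "e k \<in> E" "e k \<subseteq> topspace G" "e k \<inter> V = {}" if "k < card E" for k
    using that eE G(6) by blast+
  note cp = characteristic_map_properties[OF c ek(2)]
  define ix where "ix = inv_into {..<card V} v"
  have ix: "ix x < card V" "v (ix x) = x" if "x \<in> V" for x
    using that inv_into_into[of x v "{..<card V}"] f_inv_into_f[of x v "{..<card V}"]
    by (auto simp: ix_def vV)
  obtain d :: "real ^ 'm" where d: "norm d = 1"
    using vector_choose_size[of 1] by auto
  interpret sheets_over_graph "card V" "card E" "\<lambda>k. ix (c k 0)" "\<lambda>k. ix (c k 1)" d G v c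
  proof
    fix k assume k: "k < card E"
    show "ix (c k 0) < card V" "ix (c k 1) < card V"
      using ix(1) cp(4,5) k by auto
    \<comment> \<open>Otherwise \<open>c k\<close> itself would witness that \<open>e k\<close> is a
      loop.\<close>
    have "c k 0 \<noteq> c k 1"
      using assms(3) c[OF k] ek(1)[OF k] by (auto simp: is_loop_def)
    then show "ix (c k 0) \<noteq> ix (c k 1)"
      using ix(2) cp(4,5) k by metis
    show "continuous_map (top_of_set {0..1}) G (c k)" by (rule cp(3)[OF k k])
    show "c k 0 = v (ix (c k 0))" "c k 1 = v (ix (c k 1))" using ix(2) cp(4,5) k by auto
    show "inj_on (c k) {0<..<1}" by (rule cp(2)[OF k k])
    show "c k ` {0<..<1} \<inter> v ` {..<card V} = {}" using cp(1)[OF k k] ek(3)[OF k] vV by simp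
    show "c k ` {0<..<1} \<inter> c l ` {0<..<1} = {}" if l: "l < card E" "k \<noteq> l" for l
    proof -
      have "e k \<noteq> e l" using inj_onD[OF inj_e] k l by auto
      then show ?thesis
        using G(5) ek(1)[OF k] ek(1)[OF l(1)] cp(1)[OF k k] cp(1)[OF l(1) l(1)]
        unfolding disjoint_def by simp
    qed
  next
    show "2 \<le> DIM(real ^ 'm)" using assms(1) by simp
    have "(\<Union>k<card E. c k ` {0<..<1}) = (\<Union>k<card E. e k)"
      using cp(1) by (intro SUP_cong) auto
    also have "\<dots> = topspace G - V" using eE G(6) by simp
    finally show "topspace G = v ` {..<card V} \<union> (\<Union>k<card E. c k ` {0<..<1})"
      using vV G(3) by auto
  qed (use d G(1) inj_v in auto)
  show ?thesis
    using closed_smooth_manifold smooth_height finite_critical_values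
      is_reeb_space_of_height[unfolded vV, OF assms(2)] by blast
qed

end
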